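(* Let $f$ be a semi-global solution to $$[1-(f')^2]\,d+f f''=(d+1)[1-(f')^2]^{3/2}f$$ such that $\lim_{t\to\infty}f(t)=\frac{d}{d+1}$. Then $f$ is future unstable: generic perturbations of $f$ will either collapse in finite time or expand indefinitely in the future. There exists however a co-dimension 1 set of stable perturbations.
   Context: The equation is an ordinary differential equation for a function $f=f(t)$ with $f>0$ and $|f'|<1$. It expresses that the spherically symmetric time-like hypersurface $\{r=f(t)\}$ of the Minkowski space $\mathbb{R}^{1,d+1}$ ($t$ the time coordinate, $r$ the radial coordinate) has constant mean curvature $d+1$ with respect to the inward unit normal. "Semi-global" means that the solution exists on a ray $[t_0,\infty)$. A solution "collapses in finite time" in the future if it exists up to some finite time $T$ with $\lim_{t\nearrow T}f(t)=0$; it "expands indefinitely" in the future if it exists for all future times and $\lim_{t\to\infty}f(t)=\infty$. *)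

theory Defs
  imports "HOL-Analysis.Analysis"
begin

(* Here v is the velocity f'. Derivatives are taken within the time set I, so that on {t0..} and
   {t0..<T} they are one-sided at t0; on such intervals v and f'' are determined by f. *)
definition cmc_solution :: "nat \<Rightarrow> real set \<Rightarrow> (real \<Rightarrow> real) \<Rightarrow> (real \<Rightarrow> real) \<Rightarrow> bool" where
  "cmc_solution d I f v \<longleftrightarrow>
     (\<forall>t\<in>I. f t > 0 \<and> \<bar>v t\<bar> < 1 \<and>
        (f has_real_derivative v t) (at t within I) \<and>
        (\<exists>a. (v has_real_derivative a) (at t within I) \<and>
             (1 - (v t)\<^sup>2) * real d + f t * a
               = (real d + 1) * (1 - (v t)\<^sup>2) powr (3/2) * f t))"

(* Admissible Cauchy data (f(t0), f'(t0)). A perturbation of a solution is a solution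
   launched at t0 from nearby data. *)
definition phase_space :: "(real \<times> real) set" where
  "phase_space = {0<..} \<times> {-1<..<1}"

(* In the next definitions the solution with given Cauchy data is unique, the equation being
   a regular second-order equation on phase_space; hence the existential quantifiers just
   refer to "the" solution with data z. *)
definition collapses_in_finite_time :: "nat \<Rightarrow> real \<Rightarrow> real \<times> real \<Rightarrow> bool" where
  "collapses_in_finite_time d t0 z \<longleftrightarrow>
     (\<exists>T>t0. \<exists>g w. cmc_solution d {t0..<T} g w \<and> (g t0, w t0) = z \<and> (g \<longlongrightarrow> 0) (at_left T))"

definition expands_indefinitely :: "nat \<Rightarrow> real \<Rightarrow> real \<times> real \<Rightarrow> bool" where
  "expands_indefinitely d t0 z \<longleftrightarrow>
     (\<exists>g w. cmc_solution d {t0..} g w \<and> (g t0, w t0) = z \<and> filterlim g at_top at_top)"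

(* Lyapunov stability towards the future, with respect to perturbed data taken from D. *)
definition future_stable_within ::
    "nat \<Rightarrow> real \<Rightarrow> (real \<Rightarrow> real) \<Rightarrow> (real \<Rightarrow> real) \<Rightarrow> (real \<times> real) set \<Rightarrow> bool" where
  "future_stable_within d t0 f v D \<longleftrightarrow>
     (\<forall>\<epsilon>>0. \<exists>\<delta>>0. \<forall>z\<in>D. dist z (f t0, v t0) < \<delta> \<longrightarrow>
        (\<exists>g w. cmc_solution d {t0..} g w \<and> (g t0, w t0) = z \<and>
               (\<forall>t\<ge>t0. dist (g t, w t) (f t, v t) < \<epsilon>)))"

definition future_asymptotic ::
    "nat \<Rightarrow> real \<Rightarrow> (real \<Rightarrow> real) \<Rightarrow> (real \<Rightarrow> real) \<Rightarrow> real \<times> real \<Rightarrow> bool" where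
  "future_asymptotic d t0 f v z \<longleftrightarrow>
     (\<exists>g w. cmc_solution d {t0..} g w \<and> (g t0, w t0) = z \<and>
            ((\<lambda>t. dist (g t, w t) (f t, v t)) \<longlongrightarrow> 0) at_top)"

definition future_unstable :: "nat \<Rightarrow> real \<Rightarrow> (real \<Rightarrow> real) \<Rightarrow> (real \<Rightarrow> real) \<Rightarrow> bool" where
  "future_unstable d t0 f v \<longleftrightarrow> \<not> future_stable_within d t0 f v phase_space"

definition generic_in :: "'a::topological_space set \<Rightarrow> 'a set \<Rightarrow> bool" where
  "generic_in U A \<longleftrightarrow> (\<exists>G. open G \<and> G \<subseteq> A \<inter> U \<and> U \<subseteq> closure G)"

(* Closed embedded C^1 hypersurface of U: locally a regular level set, with G the gradient of F. *)
definition codim1_submanifold :: "'a::euclidean_space set \<Rightarrow> 'a set \<Rightarrow> bool" where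
  "codim1_submanifold U M \<longleftrightarrow>
     closedin (top_of_set U) M \<and>
     (\<forall>z\<in>M. \<exists>V F G. open V \<and> z \<in> V \<and> V \<subseteq> U \<and>
        (\<forall>y\<in>V. ((F :: 'a \<Rightarrow> real) has_derivative (\<lambda>h. G y \<bullet> h)) (at y) \<and> G y \<noteq> 0) \<and>
        continuous_on V G \<and>
        M \<inter> V = {y \<in> V. F y = 0})"

end

theory Submission
  imports Defs
begin

text \<open>A first integral reduces the second-order equation to one-dimensional mechanics: the energy
\<open>E = f ^ d / sqrt (1 - v\<^sup>2) - f ^ (d + 1)\<close>, with \<open>v = f'\<close>, is constant along solutions
(\<open>energy_conserved\<close>). Its value at rest is the potential \<open>x ^ d - x ^ (d + 1)\<close>, which vanishes at
\<open>0\<close>, increases to its maximum at \<open>r = d / (d + 1)\<close> and decreases afterwards. So the equilibrium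
\<open>(r, 0)\<close> is a saddle point, sitting on top of a potential barrier, and a solution converging to \<open>r\<close>
behaves like a particle that climbs a hill with just enough energy to come to rest at its top.

Such a solution has exactly the energy of the top (\<open>converging_solution_energy\<close>). The level set of this energy
consists of two smooth curves crossing in the saddle point, and the solution must run on the one that
moves towards it, the graph \<open>y = stable_slope d x\<close>
(\<open>converging_solution_on_stable_branch\<close>). This graph is the hypersurface of stable perturbations in the open set of all
admissible data. Explicit division of the critical polynomial by its double zero shows that it
is continuously differentiable at the saddle point too.

On the graph the equation is the scalar equation \<open>x' = stable_slope d x\<close>. Its right hand side is
decreasing (\<open>stable_slope_antimono\<close>), so its flow contracts distances
(\<open>decreasing_field_contracts\<close>); stability within the graph and convergence of all solutions on it to the
equilibrium follow, without any linearisation.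

Off the graph, energy and initial data decide the fate (\<open>off_stable_branch_dichotomy\<close>). Data of higher energy
keep the direction of their velocity, data of lower energy stay on their side of the barrier and
turn around if necessary, and data on the other critical curve run away from the top. A solution
moving without a point of rest ahead has its speed bounded below on compact sets and hence reaches
every radius ahead of it (\<open>reaches_level\<close>): it expands to infinity, or arrives at \<open>0\<close> in finite time.
Since the graph has dense complement, this is the generic behaviour; and as data of slightly higher
energy lie arbitrarily close to the given ones, it implies the instability.

The existence of the perturbed solutions comes from a Picard theorem for globally Lipschitz fields
(\<open>global_solution_of_lipschitz_field\<close>), applied to modifications that the solution does not feel:
for expansion the system for \<open>(f, \<theta>)\<close> with \<open>v = tanh \<theta>\<close>, for collapse Newton's equation on the energy level,
which remains regular at radius \<open>0\<close>, and for the graph the scalar equation on an invariant interval.\<close>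

section \<open>Global solutions of ordinary differential equations\<close>

text \<open>The Picard iteration contracts on the whole ray at once if the deviation from the initial value is
measured with the weight \<open>exp (- K (t - t0))\<close>: integrating a bound that grows like
\<open>exp (K (t - t0))\<close> gains a factor \<open>1 / K\<close>, which this estimate records.\<close>
lemma weighted_integral_bound:
  fixes h :: "real \<Rightarrow> 'a::banach"
  assumes h: "continuous_on {a..t} h" and "a \<le> t" and K: "K > 0" and C: "C \<ge> 0"
    and bound: "\<And>s. s \<in> {a..t} \<Longrightarrow> norm (h s) \<le> C * exp (K * (s - a))"
  shows "norm (exp (- (K * (t - a))) *\<^sub>R integral {a..t} h) \<le> C / K"
proof -
  have "((\<lambda>s. C * exp (K * (s - a))) has_integral
          C / K * exp (K * (t - a)) - C / K * exp (K * (a - a))) {a..t}"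
    using K \<open>a \<le> t\<close>
    by (intro fundamental_theorem_of_calculus)
       (auto intro!: derivative_eq_intros simp flip: has_real_derivative_iff_has_vector_derivative)
  then have "norm (integral {a..t} h) \<le> C / K * exp (K * (t - a)) - C / K"
    using integral_norm_bound_integral[OF integrable_continuous_interval[OF h] _ bound]
    by (fastforce simp: has_integral_iff)
  then have "norm (integral {a..t} h) \<le> C / K * exp (K * (t - a))"
    using K C by (smt (verit) divide_nonneg_pos)
  then have "exp (- (K * (t - a))) * norm (integral {a..t} h)
               \<le> exp (- (K * (t - a))) * (C / K * exp (K * (t - a)))"
    by (intro mult_left_mono) auto
  also have "\<dots> = C / K"
    by (simp add: exp_minus)
  finally show ?thesis
    by simp
qed

text \<open>Writing \<open>x s = z + exp (K (s - t0)) *\<^sub>R u s\<close> turns the integral equation into a fixed point problem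
for a bounded continuous function \<open>u\<close>, so the Banach space of bounded continuous functions supplies
the completeness. With \<open>K = 2 L + 1\<close> the map contracts at least by one half, on the whole ray at
once.\<close>
theorem global_solution_of_lipschitz_field:
  fixes F :: "'a::banach \<Rightarrow> 'a"
  assumes F: "L-lipschitz_on UNIV F"
  shows "\<exists>x. x t0 = z \<and> (\<forall>t\<ge>t0. (x has_vector_derivative F (x t)) (at t within {t0..}))"
proof -
  have L: "L \<ge> 0"
    using F by (rule lipschitz_on_nonneg)
  define K where "K = 2 * L + 1"
  have K: "K > 0" and LK: "L / K \<le> 1 / 2"
    using L by (auto simp: K_def field_simps)
  define X :: "(real \<Rightarrow>\<^sub>C 'a) \<Rightarrow> real \<Rightarrow> 'a"
    where "X u s = z + exp (K * (s - t0)) *\<^sub>R u s" for u s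
  \<comment> \<open>Times before \<open>t0\<close> are frozen at \<open>t0\<close>, because bounded continuous functions live on the whole line.\<close>
  define N where "N u t = exp (- (K * (max t0 t - t0))) *\<^sub>R integral {t0..max t0 t} (\<lambda>s. F (X u s))"
    for u t
  have contF: "continuous_on S F" for S
    using lipschitz_on_continuous_on[OF F] continuous_on_subset by blast
  have contX: "continuous_on S (X u)" for u S
    unfolding X_def by (intro continuous_intros) auto
  have contFX: "continuous_on S (\<lambda>s. F (X u s))" for u S
    by (rule continuous_on_compose2[where t = UNIV, OF contF contX]) auto
  have lipF: "norm (F x - F y) \<le> L * norm (x - y)" for x y
    using lipschitz_onD[OF F, of x y] by (simp add: dist_norm)
  have N: "N u \<in> bcontfun" for u
  proof (rule bcontfun_normI)
    have contI: "continuous_on {t0..b} (\<lambda>t. integral {t0..t} (\<lambda>s. F (X u s)))" for b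
      by (intro indefinite_integral_continuous_1 integrable_continuous_interval contFX)
    then have "isCont (\<lambda>t. integral {t0..max t0 t} (\<lambda>s. F (X u s))) t" for t
    proof -
      have "continuous_on {..<t + 1} (\<lambda>t. integral {t0..max t0 t} (\<lambda>s. F (X u s)))"
        by (rule continuous_on_compose2[where t = "{t0..max t0 (t + 1)}", OF contI])
           (auto intro!: continuous_intros)
      then show ?thesis
        by (rule continuous_on_interior) (auto simp: interior_open)
    qed
    then show "continuous_on UNIV (N u)"
      unfolding N_def
      by (intro continuous_at_imp_continuous_on ballI continuous_intros) auto
    show "norm (N u t) \<le> (norm (F z) + L * norm u) / K" for t
      unfolding N_def
    proof (rule weighted_integral_bound[OF contFX _ K])
      fix s assume s: "s \<in> {t0..max t0 t}"
      have "norm (F (X u s)) \<le> norm (F z) + norm (F (X u s) - F z)"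
        by (metis add.commute norm_diff_triangle_ineq norm_minus_commute diff_add_cancel norm_triangle_sub)
      also have "\<dots> \<le> norm (F z) + L * (exp (K * (s - t0)) * norm u)"
        using lipF[of "X u s" z] norm_bounded[of u s] L
        by (smt (verit, best) X_def add_diff_cancel_left' exp_ge_zero abs_of_nonneg mult_left_mono norm_scaleR)
      also have "\<dots> \<le> (norm (F z) + L * norm u) * exp (K * (s - t0))"
      proof -
        have "1 \<le> exp (K * (s - t0))"
          using s K by simp
        from mult_left_mono[OF this norm_ge_zero[of "F z"]] show ?thesis
          by (simp add: algebra_simps)
      qed
      finally show "norm (F (X u s)) \<le> (norm (F z) + L * norm u) * exp (K * (s - t0))" .
    qed (use L in auto)
  qed
  have "dist (Bcontfun (N u)) (Bcontfun (N w)) \<le> 1 / 2 * dist u w" for u w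
  proof (rule dist_bound)
    fix t
    have "N u t - N w t = exp (- (K * (max t0 t - t0))) *\<^sub>R
            integral {t0..max t0 t} (\<lambda>s. F (X u s) - F (X w s))"
      unfolding N_def by (simp add: integral_diff integrable_continuous_interval contFX scaleR_diff_right)
    also have "norm \<dots> \<le> L * dist u w / K"
    proof (rule weighted_integral_bound[OF _ _ K])
      fix s
      have "norm (F (X u s) - F (X w s)) \<le> L * (exp (K * (s - t0)) * dist (u s) (w s))"
        using lipF[of "X u s" "X w s"] by (simp add: X_def dist_norm flip: scaleR_diff_right)
      also have "\<dots> \<le> L * (exp (K * (s - t0)) * dist u w)"
        using L by (intro mult_left_mono dist_bounded) auto
      finally show "norm (F (X u s) - F (X w s)) \<le> L * dist u w * exp (K * (s - t0))"
        by (simp add: mult_ac)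
    qed (use L in \<open>auto intro!: continuous_intros contFX\<close>)
    also have "\<dots> \<le> 1 / 2 * dist u w"
      using mult_right_mono[OF LK zero_le_dist[of u w]] by simp
    finally show "dist (Bcontfun (N u) t) (Bcontfun (N w) t) \<le> 1 / 2 * dist u w"
      by (simp add: dist_norm Bcontfun_inverse N)
  qed
  then obtain u where "Bcontfun (N u) = u"
    using banach_fix_type[of "1/2" "\<lambda>u. Bcontfun (N u)"] by auto
  then have u: "u t = N u t" for t
    by (metis Bcontfun_inverse N)
  have X: "X u t = z + integral {t0..t} (\<lambda>s. F (X u s))" if "t \<ge> t0" for t
    unfolding X_def[of u t] u[of t] N_def using that by (simp add: exp_minus max_def)
  have "(X u has_vector_derivative F (X u t)) (at t within {t0..})" if "t \<ge> t0" for t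
  proof -
    have "((\<lambda>t. z + integral {t0..t} (\<lambda>s. F (X u s))) has_vector_derivative F (X u t))
            (at t within {t0..t + 1})"
      using that by (auto intro!: derivative_eq_intros integral_has_vector_derivative contFX)
    then have "(X u has_vector_derivative F (X u t)) (at t within {t0..t + 1})"
      by (rule has_vector_derivative_transform[rotated 2]) (use that X in auto)
    moreover have "at t within {t0..t + 1} = at t within {t0..}"
      by (rule at_within_nhd[of _ "{..<t + 1}"]) auto
    ultimately show ?thesis
      by simp
  qed
  moreover have "X u t0 = z"
    using X[of t0] by simp
  ultimately show ?thesis
    by blast
qed

section \<open>Motion on a line\<close>
lemma first_zero:
  fixes g :: "real \<Rightarrow> real"
  assumes g: "continuous_on {a..b} g" and "a \<le> b" and "g a > 0" and "g b \<le> 0"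
  obtains \<tau> where "a < \<tau>" "\<tau> \<le> b" "g \<tau> = 0" "\<And>s. a \<le> s \<Longrightarrow> s < \<tau> \<Longrightarrow> g s > 0"
proof -
  define Z where "Z = {s \<in> {a..b}. g s = 0}"
  have zero_before: "\<exists>r\<in>Z. r \<le> s" if "s \<in> {a..b}" "g s \<le> 0" for s
    using IVT2'[of g s 0 a] that \<open>g a > 0\<close> continuous_on_subset[OF g, of "{a..s}"]
    by (force simp: Z_def)
  have "closed ({a..b} \<inter> g -` {0})"
    using g by (rule continuous_closed_preimage) auto
  moreover have "{a..b} \<inter> g -` {0} = Z"
    by (auto simp: Z_def)
  ultimately have "closed Z"
    by simp
  then have "compact ({a..b} \<inter> Z)"
    by (intro compact_Int_closed compact_Icc)
  moreover have "{a..b} \<inter> Z = Z"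
    by (auto simp: Z_def)
  ultimately have "compact Z"
    by simp
  moreover have "Z \<noteq> {}"
    using zero_before[of b] \<open>a \<le> b\<close> \<open>g b \<le> 0\<close> by auto
  ultimately obtain \<tau> where \<tau>: "\<tau> \<in> Z" "\<And>s. s \<in> Z \<Longrightarrow> \<tau> \<le> s"
    using compact_attains_inf[of Z] by metis
  show thesis
  proof
    show "a < \<tau>" "\<tau> \<le> b" "g \<tau> = 0"
      using \<tau>(1) \<open>g a > 0\<close> by (auto simp: Z_def less_le)
    show "g s > 0" if "a \<le> s" "s < \<tau>" for s
      using zero_before[of s] \<tau> that by (force simp: Z_def not_le)
  qed
qed

lemma mean_value_within:
  fixes f v :: "real \<Rightarrow> real"
  assumes "a < b" and f: "\<And>t. t \<in> {a..b} \<Longrightarrow> (f has_real_derivative v t) (at t within {a..b})"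
  obtains \<xi> where "a < \<xi>" "\<xi> < b" "f b - f a = (b - a) * v \<xi>"
proof -
  have "(f has_derivative (\<lambda>h. v t * h)) (at t within {a..b})" if "t \<in> {a..b}" for t
    using f[OF that] by (simp add: has_field_derivative_def)
  from mvt_simple[OF \<open>a < b\<close> this] obtain \<xi> where "\<xi> \<in> {a<..<b}" "f b - f a = v \<xi> * (b - a)"
    by auto
  then show thesis
    by (intro that[of \<xi>]) (auto simp: mult.commute)
qed

lemma increment_ge:
  fixes f v :: "real \<Rightarrow> real"
  assumes "a \<le> b" and f: "\<And>t. t \<in> {a..b} \<Longrightarrow> (f has_real_derivative v t) (at t within {a..b})"
    and c: "\<And>t. a < t \<Longrightarrow> t < b \<Longrightarrow> v t \<ge> c"
  shows "f b - f a \<ge> (b - a) * c"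
proof (cases "a = b")
  case False
  with \<open>a \<le> b\<close> have "a < b"
    by simp
  then obtain \<xi> where \<xi>: "a < \<xi>" "\<xi> < b" "f b - f a = (b - a) * v \<xi>"
    using f by (rule mean_value_within)
  then have "(b - a) * c \<le> (b - a) * v \<xi>"
    using c by (intro mult_left_mono) auto
  with \<xi> show ?thesis
    by simp
next
  case True
  then show ?thesis
    by simp
qed

text \<open>If \<open>f\<close> exceeded \<open>b\<close>, then after the last time at level \<open>b\<close> it would stay above \<open>b\<close> with
nonpositive velocity. That last time is the first zero of the time-reversed function.\<close>
lemma barrier_above:
  fixes f v :: "real \<Rightarrow> real"
  assumes f: "\<And>t. t \<ge> t0 \<Longrightarrow> (f has_real_derivative v t) (at t within {t0..})"
    and "f t0 \<le> b" and v: "\<And>t. t \<ge> t0 \<Longrightarrow> f t > b \<Longrightarrow> v t \<le> 0" and "t \<ge> t0"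
  shows "f t \<le> b"
proof (rule ccontr)
  assume contra: "\<not> f t \<le> b"
  have "continuous_on {t0..} f"
    using f by (auto intro!: DERIV_continuous_on)
  then have "continuous_on {t0..t} (\<lambda>s. f (t0 + t - s) - b)"
    by (intro continuous_on_diff continuous_on_compose2[of "{t0..}" f "{t0..t}"] continuous_intros) auto
  then obtain \<tau> where \<tau>: "t0 < \<tau>" "\<tau> \<le> t" "f (t0 + t - \<tau>) - b = 0"
      "\<And>s. t0 \<le> s \<Longrightarrow> s < \<tau> \<Longrightarrow> f (t0 + t - s) - b > 0"
    by (rule first_zero) (use contra assms(2,4) in auto)
  then obtain \<xi> where \<xi>: "t0 + t - \<tau> < \<xi>" "\<xi> < t"
      "f t - f (t0 + t - \<tau>) = (t - (t0 + t - \<tau>)) * v \<xi>"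
    by (rule_tac mean_value_within[of "t0 + t - \<tau>" t f v])
       (auto intro!: DERIV_subset[OF f])
  have "f \<xi> > b"
    using \<tau>(4)[of "t0 + t - \<xi>"] \<xi> \<tau>(1,2) by auto
  then have "v \<xi> \<le> 0"
    using v[of \<xi>] \<xi> \<tau> by auto
  then have "(t - (t0 + t - \<tau>)) * v \<xi> \<le> 0"
    using \<tau> by (intro mult_nonneg_nonpos) auto
  with \<xi>(3) \<tau>(3) contra show False
    by auto
qed

lemma barrier_below:
  fixes f v :: "real \<Rightarrow> real"
  assumes f: "\<And>t. t \<ge> t0 \<Longrightarrow> (f has_real_derivative v t) (at t within {t0..})"
    and "f t0 \<ge> a" and v: "\<And>t. t \<ge> t0 \<Longrightarrow> f t < a \<Longrightarrow> v t \<ge> 0" and "t \<ge> t0"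
  shows "f t \<ge> a"
proof -
  have "((\<lambda>t. - f t) has_real_derivative - v t) (at t within {t0..})" if "t \<ge> t0" for t
    using DERIV_minus[OF f[OF that]] .
  then have "- f t \<le> - a"
    by (rule barrier_above) (use assms in auto)
  then show ?thesis
    by simp
qed

text \<open>At the first zero \<open>\<tau>\<close> of the velocity, \<open>f\<close> has only moved up, so \<open>f \<tau> \<ge> f a\<close>, and there a
vanishing velocity is excluded. The point is that rest has to be excluded only at positions on the
far side of the starting point.\<close>
lemma no_turning:
  fixes f v :: "real \<Rightarrow> real"
  assumes f: "\<And>t. t \<in> {a..b} \<Longrightarrow> (f has_real_derivative v t) (at t within {a..b})"
    and v: "continuous_on {a..b} v" "v a > 0"
    and nz: "\<And>t. t \<in> {a..b} \<Longrightarrow> f a \<le> f t \<Longrightarrow> v t \<noteq> 0"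
    and "t \<in> {a..b}"
  shows "v t > 0" "f a \<le> f t"
proof -
  have mono: "f a \<le> f \<tau>" if "\<And>s. a \<le> s \<Longrightarrow> s < \<tau> \<Longrightarrow> v s > 0" "\<tau> \<in> {a..b}" for \<tau>
    using increment_ge[of a \<tau> f v 0] that DERIV_subset[OF f, of _ "{a..\<tau>}"] by (auto simp: less_imp_le)
  have pos: "v t > 0" if "t \<in> {a..b}" for t
  proof (rule ccontr)
    assume "\<not> v t > 0"
    have "continuous_on {a..t} v" "a \<le> t"
      using that by (auto intro!: continuous_on_subset[OF v(1)])
    then obtain \<tau> where \<tau>: "a < \<tau>" "\<tau> \<le> t" "v \<tau> = 0" "\<And>s. a \<le> s \<Longrightarrow> s < \<tau> \<Longrightarrow> v s > 0"
      by (rule first_zero) (use v(2) \<open>\<not> v t > 0\<close> in auto)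
    with mono[of \<tau>] nz[of \<tau>] that show False
      by auto
  qed
  with \<open>t \<in> {a..b}\<close> mono[of t] show "v t > 0" "f a \<le> f t"
    by auto
qed

text \<open>A particle with energy law \<open>v\<^sup>2 = W\<close>, moving up and facing no point of rest up to the level \<open>B\<close>,
cannot turn; as \<open>W\<close> has a positive minimum on the compact interval in front of it, its speed is
bounded below and it arrives at \<open>B\<close> after a finite time.\<close>
lemma reaches_level:
  fixes f v W :: "real \<Rightarrow> real"
  assumes f: "\<And>t. t \<ge> a \<Longrightarrow> (f has_real_derivative v t) (at t within {a..})"
    and v: "continuous_on {a..} v" "v a > 0"
    and W: "continuous_on {f a..B} W" "\<And>x. x \<in> {f a..B} \<Longrightarrow> W x > 0"
    and energy: "\<And>t. t \<ge> a \<Longrightarrow> f t \<in> {f a..B} \<Longrightarrow> (v t)\<^sup>2 = W (f t)"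
  shows "\<exists>t\<ge>a. f t \<ge> B"
proof (rule ccontr)
  assume "\<not> (\<exists>t\<ge>a. f t \<ge> B)"
  then have below: "f t < B" if "t \<ge> a" for t
    using that by force
  have nt: "v t > 0" "f a \<le> f t" if "t \<ge> a" for t
  proof -
    have nz: "v s \<noteq> 0" if "s \<in> {a..t}" "f a \<le> f s" for s
    proof -
      have "f s \<in> {f a..B}"
        using below[of s] that by auto
      then show ?thesis
        using energy[of s] W(2)[of "f s"] that by auto
    qed
    show "v t > 0" "f a \<le> f t"
      using no_turning[of a t f v t] that nz DERIV_subset[OF f] v continuous_on_subset[OF v(1)]
      by (auto simp: subset_iff)
  qed
  have "f a \<in> {f a..B}"
    using below[of a] by auto
  then obtain x where x: "x \<in> {f a..B}" "\<And>y. y \<in> {f a..B} \<Longrightarrow> W x \<le> W y"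
    using continuous_attains_inf[OF compact_Icc _ W(1)] by (metis empty_iff)
  define c where "c = sqrt (W x)"
  have c: "c > 0"
    using W(2) x(1) by (simp add: c_def)
  have speed: "v t \<ge> c" if "t \<ge> a" for t
  proof -
    have "f t \<in> {f a..B}"
      using that nt(2) below by (auto simp: less_imp_le)
    with energy[OF that] x(2) have "W x \<le> (v t)\<^sup>2"
      by auto
    then show ?thesis
      using nt(1)[OF that] unfolding c_def by (simp add: real_le_lsqrt)
  qed
  define t where "t = a + (B - f a) / c"
  have "t \<ge> a"
    using below[of a] c by (simp add: t_def)
  moreover have "f t - f a \<ge> (t - a) * c"
    using \<open>t \<ge> a\<close> by (rule increment_ge) (auto intro!: speed DERIV_subset[OF f])
  ultimately show False
    using below[of t] c by (simp add: t_def)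
qed

lemma grows_to_infinity:
  fixes f v W :: "real \<Rightarrow> real"
  assumes f: "\<And>t. t \<ge> a \<Longrightarrow> (f has_real_derivative v t) (at t within {a..})"
    and v: "continuous_on {a..} v" "v a > 0"
    and W: "continuous_on {f a..} W" "\<And>x. x \<ge> f a \<Longrightarrow> W x > 0"
    and energy: "\<And>t. t \<ge> a \<Longrightarrow> f t \<ge> f a \<Longrightarrow> (v t)\<^sup>2 = W (f t)"
  shows "filterlim f at_top at_top"
  unfolding filterlim_at_top
proof
  fix B
  have "continuous_on {f a..B} W"
    by (rule continuous_on_subset[OF W(1)]) auto
  then have "\<exists>t\<ge>a. f t \<ge> B"
    by (intro reaches_level[OF f v, where W = W]) (auto intro: W(2) energy)
  then obtain t1 where t1: "t1 \<ge> a" "f t1 \<ge> B"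
    by blast
  have pos: "v t > 0" if "t \<ge> a" for t
  proof -
    have "v s \<noteq> 0" if "s \<in> {a..t}" "f a \<le> f s" for s
      using that energy[of s] W(2)[of "f s"] by auto
    moreover have "continuous_on {a..t} v"
      by (rule continuous_on_subset[OF v(1)]) auto
    moreover have "(f has_real_derivative v s) (at s within {a..t})" if "s \<in> {a..t}" for s
      by (rule DERIV_subset[OF f]) (use that in auto)
    ultimately show ?thesis
      using no_turning(1)[of a t f v t] v(2) that by auto
  qed
  have "f t \<ge> B" if "t \<ge> t1" for t
    using increment_ge[of t1 t f v 0] that t1 pos DERIV_subset[OF f, of _ "{t1..t}"] by (auto simp: less_imp_le)
  then show "eventually (\<lambda>t. B \<le> f t) at_top"
    by (rule eventually_at_top_linorderI)
qed

section \<open>Continuously differentiable real functions\<close>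
lemma C1_differentiable_on_power:
  fixes f :: "real \<Rightarrow> real"
  assumes "f C1_differentiable_on S"
  shows "(\<lambda>x. f x ^ n) C1_differentiable_on S"
proof (induction n)
  case (Suc n)
  then show ?case
    unfolding power_Suc by (intro C1_differentiable_on_mult assms)
qed simp

lemma C1_differentiable_on_sum:
  fixes f :: "'i \<Rightarrow> real \<Rightarrow> real"
  assumes "\<And>i. i \<in> A \<Longrightarrow> f i C1_differentiable_on S"
  shows "(\<lambda>x. \<Sum>i\<in>A. f i x) C1_differentiable_on S"
  using assms
proof (induction A rule: infinite_finite_induct)
  case (insert i A)
  then show ?case
    by (simp add: C1_differentiable_on_add)
qed simp_all

lemma C1_differentiable_onI_real:
  assumes "\<And>x. x \<in> S \<Longrightarrow> (f has_real_derivative D x) (at x)" and "continuous_on S D"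
  shows "f C1_differentiable_on S"
  unfolding C1_differentiable_on_def has_real_derivative_iff_has_vector_derivative[symmetric]
  using assms by (intro exI[of _ D]) auto

lemma C1_differentiable_on_sqrt:
  fixes f :: "real \<Rightarrow> real"
  assumes "f C1_differentiable_on S" and pos: "\<And>x. x \<in> S \<Longrightarrow> f x > 0"
  shows "(\<lambda>x. sqrt (f x)) C1_differentiable_on S"
proof -
  obtain D where D: "\<And>x. x \<in> S \<Longrightarrow> (f has_real_derivative D x) (at x)" and cD: "continuous_on S D"
    using assms(1) by (auto simp: C1_differentiable_on_def has_real_derivative_iff_has_vector_derivative)
  have cf: "continuous_on S f"
    using D by (meson DERIV_isCont continuous_at_imp_continuous_on)
  have "((\<lambda>x. sqrt (f x)) has_real_derivative D x * (inverse (sqrt (f x)) / 2)) (at x)" if "x \<in> S" for x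
    using DERIV_chain2[OF DERIV_real_sqrt[OF pos[OF that]] D[OF that]] by (simp add: mult.commute)
  moreover have "continuous_on S (\<lambda>x. D x * (inverse (sqrt (f x)) / 2))"
    using pos by (intro continuous_intros cf cD) force+
  ultimately show ?thesis
    by (rule C1_differentiable_onI_real)
qed

lemma C1_differentiable_on_inverse:
  fixes f :: "real \<Rightarrow> real"
  assumes "f C1_differentiable_on S" and nz: "\<And>x. x \<in> S \<Longrightarrow> f x \<noteq> 0"
  shows "(\<lambda>x. inverse (f x)) C1_differentiable_on S"
proof -
  obtain D where D: "\<And>x. x \<in> S \<Longrightarrow> (f has_real_derivative D x) (at x)" and cD: "continuous_on S D"
    using assms(1) by (auto simp: C1_differentiable_on_def has_real_derivative_iff_has_vector_derivative)
  have cf: "continuous_on S f"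
    using D by (meson DERIV_isCont continuous_at_imp_continuous_on)
  have "((\<lambda>x. inverse (f x)) has_real_derivative - (inverse (f x) * D x * inverse (f x))) (at x)"
    if "x \<in> S" for x
    using DERIV_inverse'[OF D[OF that] nz[OF that]] .
  moreover have "continuous_on S (\<lambda>x. - (inverse (f x) * D x * inverse (f x)))"
    using nz by (intro continuous_intros cf cD) auto
  ultimately show ?thesis
    by (rule C1_differentiable_onI_real)
qed

lemma C1_imp_lipschitz_on_Icc:
  fixes f :: "real \<Rightarrow> real"
  assumes "f C1_differentiable_on {a..b}"
  obtains L where "L-lipschitz_on {a..b} f"
proof -
  obtain D where D: "\<forall>x\<in>{a..b}. (f has_vector_derivative D x) (at x)"
    and cD: "continuous_on {a..b} D"
    using assms unfolding C1_differentiable_on_def by blast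
  obtain B where B: "\<forall>x\<in>{a..b}. \<bar>D x\<bar> \<le> B"
    using compact_imp_bounded[OF compact_continuous_image[OF cD compact_Icc]]
    unfolding bounded_iff by auto
  have "(max B 0)-lipschitz_on {a..b} f"
  proof (rule bounded_derivative_imp_lipschitz)
    show "(f has_derivative (\<lambda>h. h *\<^sub>R D x)) (at x within {a..b})" if "x \<in> {a..b}" for x
      using D that by (auto simp: has_vector_derivative_def intro: has_derivative_at_withinI)
    show "onorm (\<lambda>h. h *\<^sub>R D x) \<le> max B 0" if "x \<in> {a..b}" for x
    proof (rule onorm_bound)
      show "norm (h *\<^sub>R D x) \<le> max B 0 * norm h" for h
        using mult_right_mono[of "\<bar>D x\<bar>" "max B 0" "\<bar>h\<bar>"] B that by (force simp add: abs_mult mult.commute)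
    qed auto
  qed auto
  then show thesis
    by (rule that)
qed

section \<open>The conserved energy\<close>

text \<open>The energy at rest: the level sets of \<open>energy\<close> with value \<open>E\<close> lie over the region where the
potential is at most \<open>E\<close>, and meet the axis \<open>v = 0\<close> where it equals \<open>E\<close>.\<close>
definition potential :: "nat \<Rightarrow> real \<Rightarrow> real" where
  "potential d x = x ^ d - x ^ (d + 1)"

definition energy :: "nat \<Rightarrow> real \<Rightarrow> real \<Rightarrow> real" where
  "energy d x y = x ^ d / sqrt (1 - y\<^sup>2) - x ^ (d + 1)"

definition equilibrium :: "nat \<Rightarrow> real" where
  "equilibrium d = real d / (real d + 1)"

text \<open>On the energy level \<open>E\<close> the Lorentz factor is a function of the radius alone; \<open>lapse\<close> is its
inverse, that is, the value of \<open>sqrt (1 - v\<^sup>2)\<close>. On that level the equation is Newton's equation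
\<open>f'' = - lapse d E f * lapse_deriv d E f\<close> with the energy law \<open>v\<^sup>2 + (lapse d E f)\<^sup>2 = 1\<close>. For
\<open>E > 0\<close> its right hand side is smooth at \<open>f = 0\<close>, in contrast to the original equation.\<close>
definition lapse :: "nat \<Rightarrow> real \<Rightarrow> real \<Rightarrow> real" where
  "lapse d E x = x ^ d / (E + x ^ (d + 1))"

definition lapse_deriv :: "nat \<Rightarrow> real \<Rightarrow> real \<Rightarrow> real" where
  "lapse_deriv d E x = x ^ (d - 1) * (real d * E - x ^ (d + 1)) / (E + x ^ (d + 1))\<^sup>2"

lemma lapse_has_derivative:
  assumes "d \<ge> 1" and "E + x ^ (d + 1) \<noteq> 0"
  shows "(lapse d E has_real_derivative lapse_deriv d E x) (at x)"
proof -
  obtain n where d: "d = Suc n"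
    using \<open>d \<ge> 1\<close> by (cases d) auto
  have "((\<lambda>x. x ^ d / (E + x ^ (d + 1))) has_real_derivative
      (real d * x ^ (d - 1) * (E + x ^ (d + 1)) - x ^ d * (real (d + 1) * x ^ d)) /
        ((E + x ^ (d + 1)) * (E + x ^ (d + 1)))) (at x)"
  proof (rule DERIV_divide)
    show "((\<lambda>x. x ^ d) has_real_derivative real d * x ^ (d - 1)) (at x)"
      using DERIV_pow[of d x] by simp
    show "((\<lambda>x. E + x ^ (d + 1)) has_real_derivative real (d + 1) * x ^ d) (at x)"
      using DERIV_add[OF DERIV_const DERIV_pow[of "d + 1" x UNIV], of E] by simp
  qed (rule assms(2))
  moreover have "real d * x ^ (d - 1) * (E + x ^ (d + 1)) - x ^ d * (real (d + 1) * x ^ d)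
      = x ^ (d - 1) * (real d * E - x ^ (d + 1))"
    by (simp add: d algebra_simps)
  ultimately show ?thesis
    by (simp add: lapse_def[abs_def] lapse_deriv_def power2_eq_square)
qed

lemma speed_less_one: "\<bar>y :: real\<bar> < 1 \<longleftrightarrow> y\<^sup>2 < 1"
  by (simp add: abs_square_less_1)

lemma energy_level:
  assumes "x > 0" and "\<bar>y\<bar> < 1" and "energy d x y = E"
  shows "E + x ^ (d + 1) > 0" "y\<^sup>2 + (lapse d E x)\<^sup>2 = 1"
proof -
  have s: "sqrt (1 - y\<^sup>2) > 0"
    using assms(2) by (simp add: speed_less_one)
  have *: "E + x ^ (d + 1) = x ^ d / sqrt (1 - y\<^sup>2)"
    using assms(3) by (simp add: energy_def)
  with s \<open>x > 0\<close> show "E + x ^ (d + 1) > 0"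
    by simp
  have "lapse d E x = sqrt (1 - y\<^sup>2)"
    unfolding lapse_def * using s \<open>x > 0\<close> by simp
  then show "y\<^sup>2 + (lapse d E x)\<^sup>2 = 1"
    using s by simp
qed

lemma subluminal_on_level:
  assumes "x > 0" and "E + x ^ (d + 1) > 0" and "y\<^sup>2 + (lapse d E x)\<^sup>2 = 1"
  shows "\<bar>y\<bar> < 1"
proof -
  have "lapse d E x > 0"
    using assms by (simp add: lapse_def)
  then show ?thesis
    using assms(3) by (smt (verit) speed_less_one zero_less_power)
qed

lemma powr_three_halves: "(q\<^sup>2) powr (3/2) = q ^ 3" if "q > 0" for q :: real
  using powr_powr[of q 2 "3/2"] that by (simp add: powr_numeral)

text \<open>The second-order equation is the derivative of the energy law. Dividing by \<open>q = sqrt (1 - y\<^sup>2)\<close>, it says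
\<open>d q - x q' = (d + 1) q\<^sup>2 x\<close>, which is the differential equation of the lapse.\<close>
lemma newton_imp_cmc:
  assumes "d \<ge> 1" and "x > 0" and E: "E + x ^ (d + 1) > 0" and "y\<^sup>2 + (lapse d E x)\<^sup>2 = 1"
  shows "(1 - y\<^sup>2) * real d + x * - (lapse d E x * lapse_deriv d E x)
           = (real d + 1) * (1 - y\<^sup>2) powr (3/2) * x"
proof -
  define q where "q = lapse d E x"
  have q: "q > 0" and sq: "1 - y\<^sup>2 = q\<^sup>2"
    using assms by (auto simp: q_def lapse_def)
  have powr: "(1 - y\<^sup>2) powr (3/2) = q ^ 3"
    using q by (simp add: sq powr_three_halves)
  obtain n where d: "d = Suc n"
    using \<open>d \<ge> 1\<close> by (cases d) auto
  have main: "real d * q - x * lapse_deriv d E x = (real d + 1) * q\<^sup>2 * x"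
  proof -
    define D where "D = E + x ^ (d + 1)"
    have N: "real d * E - x ^ (d + 1) = real d * D - (real d + 1) * x ^ (d + 1)"
      by (simp add: D_def algebra_simps)
    have "x * x ^ (d - 1) = x ^ d"
      by (simp add: d)
    then have "real d * q - x * lapse_deriv d E x
        = real d * (x ^ d / D) - x ^ d * (real d * D - (real d + 1) * x ^ (d + 1)) / D\<^sup>2"
      unfolding q_def lapse_def lapse_deriv_def D_def[symmetric] N
      by (metis mult.assoc times_divide_eq_right)
    also have "\<dots> = (real d + 1) * (x ^ d / D)\<^sup>2 * x"
      using E unfolding D_def[symmetric] by (simp add: field_simps power2_eq_square)
    finally show ?thesis
      by (simp add: q_def lapse_def D_def)
  qed
  have "(1 - y\<^sup>2) * real d + x * - (lapse d E x * lapse_deriv d E x)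
          = q * (real d * q - x * lapse_deriv d E x)"
    unfolding sq by (simp add: q_def[symmetric] algebra_simps power2_eq_square)
  also have "\<dots> = (real d + 1) * (1 - y\<^sup>2) powr (3/2) * x"
    unfolding main powr by (simp add: power2_eq_square power3_eq_cube)
  finally show ?thesis .
qed

lemma cmc_solution_subset:
  assumes "cmc_solution d I f v" and "J \<subseteq> I"
  shows "cmc_solution d J f v"
  using assms DERIV_subset[OF _ \<open>J \<subseteq> I\<close>] unfolding cmc_solution_def by (meson subsetD)

lemma cmc_solutionD:
  assumes "cmc_solution n I f v"
  shows "t \<in> I \<Longrightarrow> f t > 0" "t \<in> I \<Longrightarrow> \<bar>v t\<bar> < 1"
    "t \<in> I \<Longrightarrow> (f has_real_derivative v t) (at t within I)" "continuous_on I v" "continuous_on I f"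
proof -
  show "t \<in> I \<Longrightarrow> f t > 0" "t \<in> I \<Longrightarrow> \<bar>v t\<bar> < 1"
    "t \<in> I \<Longrightarrow> (f has_real_derivative v t) (at t within I)"
    using assms unfolding cmc_solution_def by blast+
  show "continuous_on I v" "continuous_on I f"
    using assms unfolding cmc_solution_def continuous_on_eq_continuous_within
    by (meson DERIV_continuous)+
qed

text \<open>The derivative of the energy is \<open>f ^ (d - 1) v / (1 - v\<^sup>2) powr (3/2)\<close> times the defect in the
equation. It is the quantity belonging to the invariance under time translations.\<close>
lemma energy_conserved:
  assumes sol: "cmc_solution d I f v" and "convex I" and "s \<in> I" "t \<in> I"
  shows "energy d (f s) (v s) = energy d (f t) (v t)"
proof -
  have "((\<lambda>t. energy d (f t) (v t)) has_real_derivative 0) (at t within I)" if "t \<in> I" for t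
  proof -
    obtain a where f: "f t > 0" and v: "\<bar>v t\<bar> < 1"
      and df: "(f has_real_derivative v t) (at t within I)"
      and dv: "(v has_real_derivative a) (at t within I)"
      and eq: "(1 - (v t)\<^sup>2) * real d + f t * a = (real d + 1) * (1 - (v t)\<^sup>2) powr (3/2) * f t"
      using sol \<open>t \<in> I\<close> unfolding cmc_solution_def by blast
    define q where "q = sqrt (1 - (v t)\<^sup>2)"
    have q: "q > 0" and sq: "1 - (v t)\<^sup>2 = q\<^sup>2"
      using v by (auto simp: q_def speed_less_one)
    have eq': "q\<^sup>2 * real d + f t * a = (real d + 1) * q ^ 3 * f t"
      using eq q by (simp add: sq powr_three_halves)
    have "((\<lambda>t. energy d (f t) (v t)) has_real_derivative
             (real d * f t ^ (d - 1) * v t * q - f t ^ d * (- (v t * a) / q)) / (q * q)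
               - real (d + 1) * f t ^ d * v t) (at t within I)"
      unfolding energy_def
    proof (rule DERIV_diff)
      have "((\<lambda>t. f t ^ d) has_real_derivative real d * f t ^ (d - 1) * v t) (at t within I)"
        using DERIV_power[OF df, of d] by (simp add: mult_ac)
      moreover have "((\<lambda>t. sqrt (1 - (v t)\<^sup>2)) has_real_derivative - (v t * a) / q) (at t within I)"
        using q by (auto intro!: derivative_eq_intros dv simp: q_def field_simps)
      ultimately show "((\<lambda>t. f t ^ d / sqrt (1 - (v t)\<^sup>2)) has_real_derivative
          (real d * f t ^ (d - 1) * v t * q - f t ^ d * (- (v t * a) / q)) / (q * q)) (at t within I)"
        using q unfolding q_def by (intro DERIV_divide) auto
      show "((\<lambda>t. f t ^ (d + 1)) has_real_derivative real (d + 1) * f t ^ d * v t) (at t within I)"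
        using DERIV_power[OF df, of "d + 1"] by (simp add: mult_ac)
    qed
    moreover have "(real d * f t ^ (d - 1) * v t * q - f t ^ d * (- (v t * a) / q)) / (q * q)
               - real (d + 1) * f t ^ d * v t = 0"
    proof (cases d)
      case 0
      then show ?thesis
        using q f eq' by (simp add: field_simps power3_eq_cube power2_eq_square)
    next
      case (Suc n)
      have "(real d * f t ^ (d - 1) * v t * q - f t ^ d * (- (v t * a) / q)) / (q * q)
               - real (d + 1) * f t ^ d * v t
            = f t ^ n * v t / q ^ 3 * (q\<^sup>2 * real d + f t * a - (real d + 1) * q ^ 3 * f t)"
        using q by (simp add: Suc field_simps power3_eq_cube power2_eq_square)
      then show ?thesis
        using eq' by simp
    qed
    ultimately show ?thesis
      by simp
  qed
  then show ?thesis
    using has_field_derivative_zero_constant[OF \<open>convex I\<close>, of "\<lambda>t. energy d (f t) (v t)"] assms(3,4)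
    by metis
qed

section \<open>The critical energy level\<close>

text \<open>For the critical level, \<open>u\<close> is the radius in units of the equilibrium radius. The double zero of the
right hand side at \<open>u = 1\<close> is split off explicitly, with a quotient that is visibly positive.\<close>
lemma weighted_geometric_sum:
  fixes u :: real
  shows "(u - 1)\<^sup>2 * (\<Sum>k<d. real (k + 1) * u ^ k) = real d * u ^ (d + 1) - (real d + 1) * u ^ d + 1"
  by (induction d) (simp_all add: algebra_simps power2_eq_square)

text \<open>The quotient of the polynomial \<open>critical_energy d - potential d x\<close> by its double zero at the
equilibrium. Its positivity shows that the potential has its strict maximum there, and, after taking
a square root, that the critical level is two smooth curves crossing at the equilibrium.\<close>
definition barrier_factor :: "nat \<Rightarrow> real \<Rightarrow> real" where
  "barrier_factor d x =
     equilibrium d ^ (d - 1) / real d * (\<Sum>k<d. real (k + 1) * (x / equilibrium d) ^ k)"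

abbreviation critical_energy :: "nat \<Rightarrow> real" where
  "critical_energy d \<equiv> potential d (equilibrium d)"

context
  fixes d :: nat
  assumes d: "d \<ge> 1"
begin

lemma equilibrium_bounds: "0 < equilibrium d" "equilibrium d < 1"
  using d by (auto simp: equilibrium_def)

text \<open>This identity expresses that the equilibrium is a critical point of the potential. It decides the
sign of the acceleration on and below the critical level.\<close>
lemma critical_energy_eq: "real d * critical_energy d = equilibrium d ^ (d + 1)"
proof -
  have "real d * (1 - equilibrium d) = equilibrium d"
    by (simp add: equilibrium_def field_simps)
  then have "equilibrium d ^ d * (real d * (1 - equilibrium d)) = equilibrium d ^ d * equilibrium d"
    by simp
  then show ?thesis
    by (simp add: potential_def algebra_simps)
qed

lemma critical_energy_pos: "critical_energy d > 0"
  using critical_energy_eq equilibrium_bounds d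
  by (metis of_nat_0_le_iff zero_less_mult_pos zero_less_power mult_zero_left order_le_less)

lemma barrier_factor_pos: "barrier_factor d x > 0" if "x \<ge> 0"
proof -
  have "(\<Sum>k<d. real (k + 1) * (x / equilibrium d) ^ k) > 0"
  proof (rule sum_pos2)
    show "0 < real (0 + 1) * (x / equilibrium d) ^ 0" "0 \<in> {..<d}"
      using d by auto
  qed (use that equilibrium_bounds in auto)
  then show ?thesis
    using d equilibrium_bounds by (simp add: barrier_factor_def)
qed

lemma potential_gap:
  "critical_energy d - potential d x = (x - equilibrium d)\<^sup>2 * barrier_factor d x"
proof -
  define r where "r = equilibrium d"
  define S where "S = (\<Sum>k<d. real (k + 1) * (x / r) ^ k)"
  have r: "r > 0"
    using equilibrium_bounds by (simp add: r_def)
  obtain n where n: "d = Suc n"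
    using d by (cases d) auto
  have rpow: "r ^ (d + 1) = r ^ (d - 1) * r\<^sup>2"
    by (simp add: n power2_eq_square)
  have rd: "(real d + 1) * r = real d"
    by (simp add: r_def equilibrium_def)
  have "(x - r)\<^sup>2 * barrier_factor d x = r ^ (d + 1) / real d * ((x / r - 1)\<^sup>2 * S)"
    using r unfolding rpow
    unfolding barrier_factor_def r_def[symmetric] S_def[symmetric]
    by (simp add: divide_simps power2_eq_square)
  also have "\<dots> = r ^ (d + 1) / real d * (real d * (x / r) ^ (d + 1) - (real d + 1) * (x / r) ^ d + 1)"
    unfolding S_def weighted_geometric_sum ..
  also have "\<dots> = x ^ (d + 1) - (real d + 1) * r / real d * x ^ d + r ^ (d + 1) / real d"
    using r d by (simp add: field_simps power_divide)
  also have "\<dots> = x ^ (d + 1) - x ^ d + critical_energy d"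
    using critical_energy_eq d unfolding rd by (simp add: r_def field_simps)
  finally show ?thesis
    by (simp add: r_def potential_def)
qed

lemma potential_less_critical: "potential d x < critical_energy d" if "x \<ge> 0" "x \<noteq> equilibrium d"
proof -
  have "(x - equilibrium d)\<^sup>2 * barrier_factor d x > 0"
    using that barrier_factor_pos by simp
  then show ?thesis
    using potential_gap[of x] by simp
qed

lemma potential_le_critical: "potential d x \<le> critical_energy d" if "x \<ge> 0"
  using potential_less_critical[OF that] by (cases "x = equilibrium d") auto

lemma potential_has_derivative:
  "(potential d has_real_derivative x ^ (d - 1) * (real d - (real d + 1) * x)) (at x)"
proof -
  obtain n where n: "d = Suc n"
    using d by (cases d) auto
  show ?thesis
    unfolding potential_def[abs_def]
    by (rule derivative_eq_intros refl | simp add: n algebra_simps)+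
qed

lemma potential_mono: "potential d x \<le> potential d y" if "0 \<le> x" "x \<le> y" "y \<le> equilibrium d"
proof (rule DERIV_nonneg_imp_nondecreasing[OF \<open>x \<le> y\<close>])
  fix z assume z: "x \<le> z" "z \<le> y"
  then have "z \<le> equilibrium d" "z \<ge> 0"
    using that by auto
  then have "0 \<le> z ^ (d - 1) * (real d - (real d + 1) * z)"
    by (intro mult_nonneg_nonneg) (auto simp: equilibrium_def field_simps)
  then show "\<exists>D. (potential d has_real_derivative D) (at z) \<and> 0 \<le> D"
    using potential_has_derivative by blast
qed

lemma potential_antimono: "potential d y \<le> potential d x" if "equilibrium d \<le> x" "x \<le> y"
proof (rule DERIV_nonpos_imp_nonincreasing[OF \<open>x \<le> y\<close>])
  fix z assume z: "x \<le> z" "z \<le> y"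
  then have "z \<ge> equilibrium d" "z \<ge> 0"
    using that equilibrium_bounds by auto
  then have "z ^ (d - 1) * (real d - (real d + 1) * z) \<le> 0"
    by (intro mult_nonneg_nonpos) (auto simp: equilibrium_def field_simps)
  then show "\<exists>D. (potential d has_real_derivative D) (at z) \<and> D \<le> 0"
    using potential_has_derivative by blast
qed

lemma energy_ge_potential: "potential d x \<le> energy d x y"
  and energy_eq_potential_iff: "energy d x y = potential d x \<longleftrightarrow> y = 0" if "x > 0" "\<bar>y\<bar> < 1"
proof -
  have s: "0 < sqrt (1 - y\<^sup>2)" "sqrt (1 - y\<^sup>2) \<le> 1"
    using that(2) by (auto simp: speed_less_one)
  then have "1 / sqrt (1 - y\<^sup>2) \<ge> 1"
    by simp
  from mult_left_mono[OF this, of "x ^ d"] show "potential d x \<le> energy d x y"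
    using that by (simp add: energy_def potential_def)
  have "energy d x y = potential d x \<longleftrightarrow> sqrt (1 - y\<^sup>2) = 1"
    using that s by (auto simp: energy_def potential_def field_simps)
  then show "energy d x y = potential d x \<longleftrightarrow> y = 0"
    by simp
qed

lemma lapse_less_one_iff:
  assumes "x \<ge> 0" and "E + x ^ (d + 1) > 0"
  shows "1 - (lapse d E x)\<^sup>2 > 0 \<longleftrightarrow> potential d x < E"
proof -
  have "lapse d E x \<ge> 0"
    using assms by (simp add: lapse_def)
  then have "1 - (lapse d E x)\<^sup>2 > 0 \<longleftrightarrow> lapse d E x < 1"
    by (simp add: power_less_one_iff abs_square_less_1)
  also have "\<dots> \<longleftrightarrow> potential d x < E"
    using assms by (auto simp: lapse_def potential_def field_simps)
  finally show ?thesis .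
qed

end

section \<open>The stable branch of the critical level\<close>

text \<open>The branch of the critical level that moves towards the equilibrium. The naive formula
\<open>sqrt (1 - (lapse d E x)\<^sup>2)\<close> has a corner at the equilibrium; extracting the factor
\<open>equilibrium d - x\<close> first gives the right sign on both sides and a smooth function.\<close>
definition stable_slope :: "nat \<Rightarrow> real \<Rightarrow> real" where
  "stable_slope d x = (equilibrium d - x) *
     (sqrt (barrier_factor d x * (critical_energy d + x ^ (d + 1) + x ^ d))
        * inverse (critical_energy d + x ^ (d + 1)))"

context
  fixes d :: nat
  assumes d: "d \<ge> 1"
begin

lemma critical_denominator_pos: "critical_energy d + x ^ (d + 1) > 0" if "x \<ge> 0"
proof (rule add_pos_nonneg)
  show "critical_energy d > 0"
    by (rule critical_energy_pos[OF d])
  show "x ^ (d + 1) \<ge> 0"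
    by (rule zero_le_power[OF that])
qed

lemma critical_radicand_pos:
  "barrier_factor d x * (critical_energy d + x ^ (d + 1) + x ^ d) > 0" if "x > 0"
proof (rule mult_pos_pos)
  show "critical_energy d + x ^ (d + 1) + x ^ d > 0"
    using add_pos_pos[OF critical_denominator_pos zero_less_power[OF that]] that by simp
qed (use that barrier_factor_pos[OF d] in auto)

lemma stable_slope_sign:
  assumes "x > 0"
  shows "x < equilibrium d \<Longrightarrow> stable_slope d x > 0"
    and "x > equilibrium d \<Longrightarrow> stable_slope d x < 0"
    and "stable_slope d x = 0 \<longleftrightarrow> x = equilibrium d"
proof -
  have "sqrt (barrier_factor d x * (critical_energy d + x ^ (d + 1) + x ^ d))
          * inverse (critical_energy d + x ^ (d + 1)) > 0"
    using assms critical_denominator_pos[of x] critical_radicand_pos[of x]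
    by (intro mult_pos_pos) auto
  then show "x < equilibrium d \<Longrightarrow> stable_slope d x > 0"
    and "x > equilibrium d \<Longrightarrow> stable_slope d x < 0"
    and "stable_slope d x = 0 \<longleftrightarrow> x = equilibrium d"
    unfolding stable_slope_def by (auto intro: mult_neg_pos)
qed

lemma stable_slope_on_critical_level:
  assumes "x > 0"
  shows "(stable_slope d x)\<^sup>2 + (lapse d (critical_energy d) x)\<^sup>2 = 1"
proof -
  define D where "D = critical_energy d + x ^ (d + 1)"
  have D: "D > 0"
    using critical_denominator_pos[of x] assms by (simp add: D_def)
  have "(equilibrium d - x)\<^sup>2 * barrier_factor d x = D - x ^ d"
    using potential_gap[OF d, of x]
    by (simp add: D_def potential_def power2_commute[of x] algebra_simps)
  moreover have "(stable_slope d x)\<^sup>2 = (equilibrium d - x)\<^sup>2 * barrier_factor d x * (D + x ^ d) / D\<^sup>2"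
    using critical_radicand_pos[OF assms]
    unfolding stable_slope_def D_def[symmetric]
    by (simp add: power_mult_distrib divide_inverse power_inverse)
  ultimately have "(stable_slope d x)\<^sup>2 = (D - x ^ d) * (D + x ^ d) / D\<^sup>2"
    by simp
  then show ?thesis
    using D unfolding lapse_def D_def[symmetric] by (simp add: field_simps power2_eq_square)
qed

lemma stable_slope_C1: "stable_slope d C1_differentiable_on {0<..}"
proof -
  have pow: "(\<lambda>x :: real. x ^ n) C1_differentiable_on S" for n S
    by (intro C1_differentiable_on_power) simp
  have "(\<lambda>x. barrier_factor d x) C1_differentiable_on {0<..}"
    unfolding barrier_factor_def divide_inverse[of _ "equilibrium d"]
    by (intro C1_differentiable_on_mult C1_differentiable_on_sum C1_differentiable_on_power) auto
  then show ?thesis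
    unfolding stable_slope_def[abs_def]
  proof (intro C1_differentiable_on_mult C1_differentiable_on_sqrt C1_differentiable_on_inverse
      C1_differentiable_on_add C1_differentiable_on_diff pow)
    fix x :: real assume "x \<in> {0<..}"
    then show "barrier_factor d x * (critical_energy d + x ^ (d + 1) + x ^ d) > 0"
      "critical_energy d + x ^ (d + 1) \<noteq> 0"
      using critical_radicand_pos[of x] critical_denominator_pos[of x] by auto
  qed auto
qed

text \<open>The last equation is the derivative of the energy law along the branch. It gives the acceleration of
the flow \<open>x' = stable_slope d x\<close> without dividing by the slope, and so also at the equilibrium.\<close>
lemma stable_slope_derivative:
  obtains D where "continuous_on {0<..} D"
    "\<And>x. x > 0 \<Longrightarrow> (stable_slope d has_real_derivative D x) (at x)"
    "\<And>x. x > 0 \<Longrightarrow> D x * stable_slope d x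
        = - (lapse d (critical_energy d) x * lapse_deriv d (critical_energy d) x)"
proof -
  obtain D where cD: "continuous_on {0<..} D"
    and D: "\<And>x. x > 0 \<Longrightarrow> (stable_slope d has_real_derivative D x) (at x)"
    using stable_slope_C1
    by (auto simp: C1_differentiable_on_def has_real_derivative_iff_has_vector_derivative)
  have "D x * stable_slope d x
        = - (lapse d (critical_energy d) x * lapse_deriv d (critical_energy d) x)" if "x > 0" for x
  proof -
    let ?E = "critical_energy d"
    have l: "(lapse d ?E has_real_derivative lapse_deriv d ?E x) (at x)"
      using that critical_denominator_pos[of x] by (intro lapse_has_derivative[OF d]) auto
    have "((\<lambda>x. (stable_slope d x)\<^sup>2 + (lapse d ?E x)\<^sup>2) has_real_derivative
        2 * (D x * stable_slope d x) + 2 * (lapse_deriv d ?E x * lapse d ?E x)) (at x)"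
      by (auto intro!: derivative_eq_intros D[OF that] l)
    moreover have "((\<lambda>x. (stable_slope d x)\<^sup>2 + (lapse d ?E x)\<^sup>2) has_real_derivative 0) (at x)"
    proof (rule has_field_derivative_transform_within_open[where S = "{0<..}"])
      show "((\<lambda>x. 1) has_real_derivative 0) (at x)"
        by simp
    qed (use that stable_slope_on_critical_level in auto)
    ultimately show ?thesis
      by (auto dest: DERIV_unique simp: mult.commute)
  qed
  with cD D show thesis
    by (rule that)
qed

text \<open>On the critical level the derivative of the lapse has the sign of \<open>r ^ (d + 1) - x ^ (d + 1)\<close>, where \<open>r\<close> is the
equilibrium radius, because \<open>d\<close> times the critical energy is \<open>r ^ (d + 1)\<close>.\<close>
lemma critical_lapse_mono:
  assumes "0 < x" "x \<le> y"
  shows "y \<le> equilibrium d \<Longrightarrow> lapse d (critical_energy d) x \<le> lapse d (critical_energy d) y"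
    and "equilibrium d \<le> x \<Longrightarrow> lapse d (critical_energy d) y \<le> lapse d (critical_energy d) x"
proof -
  let ?q = "lapse d (critical_energy d)" and ?r = "equilibrium d"
  have q: "(?q has_real_derivative lapse_deriv d (critical_energy d) z) (at z)" if "z > 0" for z
    using critical_denominator_pos[of z] that by (intro lapse_has_derivative[OF d]) auto
  have q': "lapse_deriv d (critical_energy d) z
      = z ^ (d - 1) * (?r ^ (d + 1) - z ^ (d + 1)) / (critical_energy d + z ^ (d + 1))\<^sup>2" for z
    unfolding lapse_deriv_def critical_energy_eq[OF d] ..
  show "?q x \<le> ?q y" if "y \<le> ?r"
  proof (rule DERIV_nonneg_imp_nondecreasing[OF \<open>x \<le> y\<close>])
    fix z assume z: "x \<le> z" "z \<le> y"
    then have "z ^ (d + 1) \<le> ?r ^ (d + 1)" "z > 0"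
      using assms that by (auto intro!: power_mono simp del: power_Suc)
    then have "0 \<le> lapse_deriv d (critical_energy d) z"
      by (simp add: q' del: power_Suc)
    then show "\<exists>D. (?q has_real_derivative D) (at z) \<and> 0 \<le> D"
      using q[OF \<open>z > 0\<close>] by blast
  qed
  show "?q y \<le> ?q x" if "?r \<le> x"
  proof (rule DERIV_nonpos_imp_nonincreasing[OF \<open>x \<le> y\<close>])
    fix z assume z: "x \<le> z" "z \<le> y"
    then have "?r ^ (d + 1) \<le> z ^ (d + 1)" "z > 0"
      using assms that equilibrium_bounds[OF d] by (auto intro!: power_mono simp del: power_Suc)
    then have "lapse_deriv d (critical_energy d) z \<le> 0"
      by (simp add: q' divide_nonpos_nonneg mult_nonneg_nonpos del: power_Suc)
    then show "\<exists>D. (?q has_real_derivative D) (at z) \<and> D \<le> 0"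
      using q[OF \<open>z > 0\<close>] by blast
  qed
qed

text \<open>By the energy law, monotonicity of the lapse on either side of the equilibrium makes the absolute
value of the slope grow away from the equilibrium; the sign change there does the rest. Thus the flow on the
branch contracts distances, which is what makes all its solutions stable relative to each other.\<close>
lemma stable_slope_antimono:
  assumes "0 < x" "x \<le> y"
  shows "stable_slope d y \<le> stable_slope d x"
proof -
  let ?q = "lapse d (critical_energy d)" and ?r = "equilibrium d"
  have sq: "(stable_slope d z)\<^sup>2 = 1 - (?q z)\<^sup>2" if "z > 0" for z
    using stable_slope_on_critical_level[OF that] by simp
  have q: "?q z \<ge> 0" if "z > 0" for z
    using critical_denominator_pos[of z] that by (simp add: lapse_def)
  have sign: "z \<le> ?r \<Longrightarrow> stable_slope d z \<ge> 0" "z \<ge> ?r \<Longrightarrow> stable_slope d z \<le> 0" if "z > 0" for z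
    using stable_slope_sign[OF that] by (auto simp: le_less)
  consider "y \<le> ?r" | "x \<le> ?r" "?r \<le> y" | "?r \<le> x"
    by linarith
  then show ?thesis
  proof cases
    case 1
    then have "(?q x)\<^sup>2 \<le> (?q y)\<^sup>2"
      using critical_lapse_mono(1)[OF assms] q assms by (intro power_mono) auto
    then have "(stable_slope d y)\<^sup>2 \<le> (stable_slope d x)\<^sup>2"
      using sq assms by auto
    from power2_le_imp_le[OF this] show ?thesis
      using sign(1)[of x] 1 assms by auto
  next
    case 2
    then show ?thesis
      using sign(1)[of x] sign(2)[of y] assms by auto
  next
    case 3
    then have "(?q y)\<^sup>2 \<le> (?q x)\<^sup>2"
      using critical_lapse_mono(2)[OF assms] q assms by (intro power_mono) auto
    then have "(- stable_slope d x)\<^sup>2 \<le> (- stable_slope d y)\<^sup>2"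
      using sq assms by auto
    from power2_le_imp_le[OF this] have "- stable_slope d x \<le> - stable_slope d y"
      using sign(2)[of y] 3 assms by auto
    then show ?thesis
      by simp
  qed
qed

end

section \<open>The flow on the stable branch\<close>

text \<open>The field is frozen outside the interval, which makes it globally Lipschitz; the signs at the end
points prevent the solution from leaving the interval, so that it never sees the modification.\<close>
lemma invariant_interval_solution:
  fixes F :: "real \<Rightarrow> real"
  assumes F: "L-lipschitz_on {a..b} F" and "F a \<ge> 0" and "F b \<le> 0" and z: "z \<in> {a..b}"
  shows "\<exists>g. g t0 = z \<and> (\<forall>t\<ge>t0. g t \<in> {a..b} \<and> (g has_real_derivative F (g t)) (at t within {t0..}))"
proof -
  define clamp where "clamp x = max a (min b x)" for x
  have clamp: "clamp x \<in> {a..b}" for x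
    using z by (auto simp: clamp_def)
  have "L-lipschitz_on UNIV (\<lambda>x. F (clamp x))"
  proof (rule lipschitz_onI)
    fix x y :: real
    have "dist (F (clamp x)) (F (clamp y)) \<le> L * dist (clamp x) (clamp y)"
      by (rule lipschitz_onD[OF F clamp clamp])
    also have "\<dots> \<le> L * dist x y"
      using lipschitz_on_nonneg[OF F] by (intro mult_left_mono) (auto simp: clamp_def dist_real_def)
    finally show "dist (F (clamp x)) (F (clamp y)) \<le> L * dist x y" .
  qed (rule lipschitz_on_nonneg[OF F])
  from global_solution_of_lipschitz_field[OF this, of t0 z] obtain g where g0: "g t0 = z"
    and g: "\<And>t. t \<ge> t0 \<Longrightarrow> (g has_real_derivative F (clamp (g t))) (at t within {t0..})"
    by (auto simp: has_real_derivative_iff_has_vector_derivative)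
  have "g t \<le> b" if "t \<ge> t0" for t
    by (rule barrier_above[OF g]) (use z g0 \<open>F b \<le> 0\<close> that in \<open>auto simp: clamp_def\<close>)
  moreover have "g t \<ge> a" if "t \<ge> t0" for t
    by (rule barrier_below[OF g]) (use z g0 \<open>F a \<ge> 0\<close> that in \<open>auto simp: clamp_def min_def\<close>)
  ultimately have bounds: "g t \<in> {a..b}" if "t \<ge> t0" for t
    using that by auto
  then have "clamp (g t) = g t" if "t \<ge> t0" for t
    using that by (force simp: clamp_def)
  with g0 g bounds show ?thesis
    by (intro exI[of _ g]) auto
qed

lemma decreasing_field_contracts:
  fixes F :: "real \<Rightarrow> real"
  assumes F: "\<And>x y. 0 < x \<Longrightarrow> x \<le> y \<Longrightarrow> F y \<le> F x"
    and f: "\<And>t. t \<ge> t0 \<Longrightarrow> f t > 0 \<and> (f has_real_derivative F (f t)) (at t within {t0..})"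
    and g: "\<And>t. t \<ge> t0 \<Longrightarrow> g t > 0 \<and> (g has_real_derivative F (g t)) (at t within {t0..})"
    and "t0 \<le> s" "s \<le> t"
  shows "\<bar>f t - g t\<bar> \<le> \<bar>f s - g s\<bar>"
proof -
  have der: "((\<lambda>t. - (f t - g t)\<^sup>2) has_real_derivative - (2 * (f u - g u) * (F (f u) - F (g u))))
      (at u within {s..t})" if "u \<in> {s..t}" for u
  proof -
    have "(f has_real_derivative F (f u)) (at u within {s..t})"
      "(g has_real_derivative F (g u)) (at u within {s..t})"
      using f[of u] g[of u] that \<open>t0 \<le> s\<close> by (auto elim: DERIV_subset)
    then show ?thesis
      by (auto intro!: derivative_eq_intros)
  qed
  have "- (f t - g t)\<^sup>2 - - (f s - g s)\<^sup>2 \<ge> (t - s) * 0"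
  proof (rule increment_ge[OF \<open>s \<le> t\<close> der])
    fix u assume "s < u" "u < t"
    then have "f u > 0" "g u > 0"
      using f g \<open>t0 \<le> s\<close> by auto
    then have "(f u - g u) * (F (f u) - F (g u)) \<le> 0"
      using F[of "f u" "g u"] F[of "g u" "f u"]
      by (cases "f u \<le> g u") (auto intro: mult_nonpos_nonneg mult_nonneg_nonpos)
    then show "0 \<le> - (2 * (f u - g u) * (F (f u) - F (g u)))"
      unfolding mult.assoc by linarith
  qed
  then show ?thesis
    by (simp add: abs_le_square_iff)
qed

context
  fixes d :: nat
  assumes d: "d \<ge> 1"
begin

lemma stable_slope_C1_on: "S \<subseteq> {0<..} \<Longrightarrow> stable_slope d C1_differentiable_on S"
  using stable_slope_C1[OF d] C1_differentiable_on_subset by blast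

lemma continuous_on_stable_slope: "continuous_on {0<..} (stable_slope d)"
  using stable_slope_C1[OF d] C1_diff_imp_diff differentiable_imp_continuous_on by blast

lemma stable_slope_speed: "\<bar>stable_slope d x\<bar> < 1" if "x > 0"
  using subluminal_on_level[OF that critical_denominator_pos[OF d] stable_slope_on_critical_level[OF d that]] that
  by simp

lemma stable_flow_is_cmc:
  assumes g: "\<And>t. t \<ge> t0 \<Longrightarrow> g t > 0 \<and> (g has_real_derivative stable_slope d (g t)) (at t within {t0..})"
  shows "cmc_solution d {t0..} g (\<lambda>t. stable_slope d (g t))"
  unfolding cmc_solution_def
proof (intro ballI conjI)
  fix t assume "t \<in> {t0..}"
  then have t: "g t > 0" "(g has_real_derivative stable_slope d (g t)) (at t within {t0..})"
    using g by auto
  obtain D where D: "\<And>x. x > 0 \<Longrightarrow> (stable_slope d has_real_derivative D x) (at x)"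
    and DD: "\<And>x. x > 0 \<Longrightarrow> D x * stable_slope d x
        = - (lapse d (critical_energy d) x * lapse_deriv d (critical_energy d) x)"
    using stable_slope_derivative[OF d] by metis
  show "g t > 0" "(g has_real_derivative stable_slope d (g t)) (at t within {t0..})"
    by (fact t)+
  show "\<bar>stable_slope d (g t)\<bar> < 1"
    by (rule stable_slope_speed[OF t(1)])
  have "((\<lambda>t. stable_slope d (g t)) has_real_derivative D (g t) * stable_slope d (g t)) (at t within {t0..})"
    by (rule DERIV_chain2[OF D[OF t(1)] t(2)])
  then have "((\<lambda>t. stable_slope d (g t)) has_real_derivative
      - (lapse d (critical_energy d) (g t) * lapse_deriv d (critical_energy d) (g t))) (at t within {t0..})"
    unfolding DD[OF t(1)] .
  then show "\<exists>a. ((\<lambda>t. stable_slope d (g t)) has_real_derivative a) (at t within {t0..}) \<and>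
      (1 - (stable_slope d (g t))\<^sup>2) * real d + g t * a
        = (real d + 1) * (1 - (stable_slope d (g t))\<^sup>2) powr (3/2) * g t"
    using newton_imp_cmc[OF d t(1) critical_denominator_pos[OF d] stable_slope_on_critical_level[OF d t(1)]] t(1)
    by (intro exI conjI) auto
qed

lemma stable_flow_exists:
  assumes "x0 > 0"
  obtains g where "g t0 = x0"
    "\<And>t. t \<ge> t0 \<Longrightarrow> g t > 0 \<and> (g has_real_derivative stable_slope d (g t)) (at t within {t0..})"
proof -
  define a b where "a = min x0 (equilibrium d)" and "b = max x0 (equilibrium d)"
  have a: "a > 0" and ab: "a \<le> b"
    using assms equilibrium_bounds[OF d] by (auto simp: a_def b_def)
  obtain L where "L-lipschitz_on {a..b} (stable_slope d)"
    by (rule C1_imp_lipschitz_on_Icc[OF stable_slope_C1_on]) (use a in auto)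
  moreover have "stable_slope d a \<ge> 0"
    using stable_slope_sign[OF d a] by (force simp: a_def)
  moreover have "stable_slope d b \<le> 0"
    using stable_slope_sign[OF d, of b] a ab by (force simp: b_def)
  moreover have "x0 \<in> {a..b}"
    by (auto simp: a_def b_def)
  ultimately obtain g where "g t0 = x0"
    and g: "\<forall>t\<ge>t0. g t \<in> {a..b} \<and> (g has_real_derivative stable_slope d (g t)) (at t within {t0..})"
    using invariant_interval_solution by blast
  moreover have "g t > 0" if "t \<ge> t0" for t
    using g that a by (meson atLeastAtMost_iff less_le_trans)
  ultimately show thesis
    by (intro that[of g]) auto
qed

text \<open>While the distance to the equilibrium is at least \<open>h\<close>, its square decreases at a rate bounded below, by
monotonicity of the slope, so the distance falls below \<open>h\<close> at some time. Since
the equilibrium is itself a solution, contraction keeps it below \<open>h\<close> afterwards.\<close>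
lemma stable_flow_converges:
  assumes g: "\<And>t. t \<ge> t0 \<Longrightarrow> g t > 0 \<and> (g has_real_derivative stable_slope d (g t)) (at t within {t0..})"
  shows "(g \<longlongrightarrow> equilibrium d) at_top"
proof (rule tendstoI)
  let ?r = "equilibrium d"
  fix e :: real assume "e > 0"
  define h where "h = min e ?r / 2"
  have h: "0 < h" "h < ?r" "h < e"
    using \<open>e > 0\<close> equilibrium_bounds[OF d] by (auto simp: h_def min_def)
  define c where "c = h * min (stable_slope d (?r - h)) (- stable_slope d (?r + h))"
  have c: "c > 0"
    using h stable_slope_sign[OF d, of "?r - h"] stable_slope_sign[OF d, of "?r + h"]
      equilibrium_bounds[OF d] by (auto simp: c_def)
  have drift: "(?r - x) * stable_slope d x \<ge> c" if "x > 0" "\<bar>x - ?r\<bar> \<ge> h" for x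
  proof (cases "x > ?r")
    case True
    then have "h * (- stable_slope d (?r + h)) \<le> (x - ?r) * (- stable_slope d x)"
      using that h c stable_slope_antimono[OF d, of "?r + h" x] equilibrium_bounds[OF d]
        stable_slope_sign(2)[OF d, of "?r + h"]
      by (intro mult_mono) auto
    then show ?thesis
      using h unfolding c_def by (smt (verit) min.cobounded2 mult_left_mono minus_mult_minus minus_diff_eq)
  next
    case False
    then have "h * stable_slope d (?r - h) \<le> (?r - x) * stable_slope d x"
      using that h c stable_slope_antimono[OF d, of x "?r - h"] equilibrium_bounds[OF d]
        stable_slope_sign(1)[OF d, of "?r - h"]
      by (intro mult_mono) auto
    then show ?thesis
      using h unfolding c_def by (smt (verit) min.cobounded1 mult_left_mono)
  qed
  have der: "((\<lambda>t. - (g t - ?r)\<^sup>2) has_real_derivative 2 * ((?r - g u) * stable_slope d (g u)))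
      (at u within {t0..})" if "u \<ge> t0" for u
    using g[OF that] by (auto intro!: derivative_eq_intros simp: algebra_simps)
  have "\<exists>s\<ge>t0. \<bar>g s - ?r\<bar> < h"
  proof (rule ccontr)
    assume "\<not> ?thesis"
    then have far: "\<bar>g s - ?r\<bar> \<ge> h" if "s \<ge> t0" for s
      using that by force
    \<comment> \<open>At this time the square of the distance would be negative.\<close>
    define t where "t = t0 + ((g t0 - ?r)\<^sup>2 + 1) / (2 * c)"
    have "t \<ge> t0"
      using c by (simp add: t_def)
    then have "- (g t - ?r)\<^sup>2 - - (g t0 - ?r)\<^sup>2 \<ge> (t - t0) * (2 * c)"
      by (rule increment_ge) (use drift far g in \<open>auto intro!: DERIV_subset[OF der]\<close>)
    also have "(t - t0) * (2 * c) = (g t0 - ?r)\<^sup>2 + 1"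
      using c by (simp add: t_def)
    finally show False
      by (smt (verit) zero_le_power2)
  qed
  then obtain s where s: "s \<ge> t0" "\<bar>g s - ?r\<bar> < h"
    by blast
  have "dist (g t) ?r < e" if "t \<ge> s" for t
  proof -
    have "\<bar>g t - ?r\<bar> \<le> \<bar>g s - ?r\<bar>"
    proof (rule decreasing_field_contracts[of "stable_slope d" t0 g "\<lambda>_. ?r" s t])
      show "?r > 0 \<and> ((\<lambda>_. ?r) has_real_derivative stable_slope d ?r) (at t within {t0..})" for t
        using stable_slope_sign(3)[OF d, of ?r] equilibrium_bounds[OF d] by auto
    qed (use stable_slope_antimono[OF d] g s that in auto)
    with s h show ?thesis
      by (simp add: dist_real_def)
  qed
  then show "eventually (\<lambda>t. dist (g t) ?r < e) at_top"
    by (rule eventually_at_top_linorderI)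
qed

lemma stable_flow_slope_converges:
  assumes g: "\<And>t. t \<ge> t0 \<Longrightarrow> g t > 0 \<and> (g has_real_derivative stable_slope d (g t)) (at t within {t0..})"
  shows "((\<lambda>t. stable_slope d (g t)) \<longlongrightarrow> 0) at_top"
proof -
  have "isCont (stable_slope d) (equilibrium d)"
    using continuous_on_stable_slope equilibrium_bounds[OF d]
    by (simp add: continuous_on_eq_continuous_at)
  then have "((\<lambda>t. stable_slope d (g t)) \<longlongrightarrow> stable_slope d (equilibrium d)) at_top"
    using stable_flow_converges[OF g] isCont_tendsto_compose by blast
  then show ?thesis
    using stable_slope_sign(3)[OF d, of "equilibrium d"] equilibrium_bounds[OF d] by simp
qed

text \<open>By the mean value theorem, \<open>f (n + 1) - f n\<close> is the velocity at some time between; these differences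
tend to zero. Along these times the data approach the equilibrium at rest, so the constant energy is its
energy.\<close>
lemma converging_solution_energy:
  assumes sol: "cmc_solution d {t0..} f v" and lim: "(f \<longlongrightarrow> equilibrium d) at_top" and "t \<ge> t0"
  shows "energy d (f t) (v t) = critical_energy d"
proof -
  note f = cmc_solutionD[OF sol]
  have "\<exists>\<xi>. t0 + real n < \<xi> \<and> \<xi> < t0 + real n + 1 \<and> v \<xi> = f (t0 + real n + 1) - f (t0 + real n)" for n
  proof -
    obtain \<xi> where "t0 + real n < \<xi>" "\<xi> < t0 + real n + 1"
      "f (t0 + real n + 1) - f (t0 + real n) = (t0 + real n + 1 - (t0 + real n)) * v \<xi>"
      by (rule mean_value_within[of "t0 + real n" "t0 + real n + 1" f v])
         (auto intro!: DERIV_subset[OF f(3)])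
    then show ?thesis
      by auto
  qed
  then obtain \<xi> where \<xi>: "t0 + real n < \<xi> n" "v (\<xi> n) = f (t0 + real n + 1) - f (t0 + real n)" for n
    by metis
  have top: "filterlim (\<lambda>n. t0 + real n + c) at_top sequentially" for c
    by (simp add: add.assoc add.commute[of _ c] filterlim_tendsto_add_at_top[OF tendsto_const] filterlim_real_sequentially)
  have "filterlim (\<lambda>n. t0 + real n + 0) at_top sequentially"
    by (rule top)
  then have "filterlim \<xi> at_top sequentially"
    by (rule filterlim_at_top_mono) (auto intro!: always_eventually less_imp_le \<xi>(1))
  then have f\<xi>: "(\<lambda>n. f (\<xi> n)) \<longlonglongrightarrow> equilibrium d"
    by (rule filterlim_compose[OF lim])
  have "(\<lambda>n. f (t0 + real n + 1) - f (t0 + real n + 0)) \<longlonglongrightarrow> equilibrium d - equilibrium d"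
    by (intro tendsto_diff filterlim_compose[OF lim] top)
  then have v\<xi>: "(\<lambda>n. v (\<xi> n)) \<longlonglongrightarrow> 0"
    by (simp add: \<xi>(2))
  have "(\<lambda>n. energy d (f (\<xi> n)) (v (\<xi> n))) \<longlonglongrightarrow>
      equilibrium d ^ d / sqrt (1 - 0\<^sup>2) - equilibrium d ^ (d + 1)"
    unfolding energy_def by (intro tendsto_intros f\<xi> v\<xi>) simp
  moreover have "energy d (f (\<xi> n)) (v (\<xi> n)) = energy d (f t) (v t)" for n
    using \<open>t \<ge> t0\<close> \<xi>(1)[of n] by (intro energy_conserved[OF sol]) auto
  ultimately have "(\<lambda>n :: nat. energy d (f t) (v t)) \<longlonglongrightarrow> critical_energy d"
    by (simp add: potential_def)
  then show ?thesis
    using LIMSEQ_unique tendsto_const by blast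
qed

text \<open>On the critical level the velocity is \<open>\<plusminus> stable_slope\<close>. With the wrong sign at one time, the solution
moves away from the equilibrium; it cannot turn, as the level has no other point of rest, and so it
cannot converge to the equilibrium.\<close>
lemma converging_solution_on_stable_branch:
  assumes sol: "cmc_solution d {t0..} f v" and lim: "(f \<longlongrightarrow> equilibrium d) at_top" and "t \<ge> t0"
  shows "v t = stable_slope d (f t)"
proof (rule ccontr)
  assume neq: "v t \<noteq> stable_slope d (f t)"
  let ?r = "equilibrium d"
  note f = cmc_solutionD[OF sol]
  have sq: "(v s)\<^sup>2 = (stable_slope d (f s))\<^sup>2" if "s \<ge> t0" for s
    using energy_level(2)[OF f(1) f(2) converging_solution_energy[OF sol lim]]
      stable_slope_on_critical_level[OF d f(1)] that by (smt (verit) atLeast_iff)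
  have nz: "v s \<noteq> 0" if "s \<ge> t0" "f s \<noteq> ?r" for s
    using sq[OF that(1)] stable_slope_sign(3)[OF d f(1), of s] that by auto
  have vt: "v t = - stable_slope d (f t)"
    using sq[OF \<open>t \<ge> t0\<close>] neq by (auto simp: power2_eq_iff)
  have der: "(f has_real_derivative v s) (at s within {t..u})" if "s \<in> {t..u}" for s u
    by (rule DERIV_subset[OF f(3)]) (use that \<open>t \<ge> t0\<close> in auto)
  have cont: "continuous_on {t..u} v" for u
    by (rule continuous_on_subset[OF f(4)]) (use \<open>t \<ge> t0\<close> in auto)
  have ft: "f t > 0"
    using f(1) \<open>t \<ge> t0\<close> by auto
  have "f t \<noteq> ?r"
    using vt neq stable_slope_sign(3)[OF d ft] by auto
  then consider "f t > ?r" | "f t < ?r"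
    by linarith
  then show False
  proof cases
    case 1
    then have "v t > 0"
      using vt stable_slope_sign(2)[OF d ft] by auto
    have "f u \<ge> f t" if "u \<ge> t" for u
      by (rule no_turning(2)[of t u f v u]) (use that \<open>v t > 0\<close> der cont nz 1 \<open>t \<ge> t0\<close> in auto)
    then have "?r \<ge> f t"
      by (intro tendsto_lowerbound[OF lim] eventually_at_top_linorderI) auto
    with 1 show False
      by simp
  next
    case 2
    then have "- v t > 0"
      using vt stable_slope_sign(1)[OF d ft] by auto
    have "- f u \<ge> - f t" if "u \<ge> t" for u
      by (rule no_turning(2)[of t u "\<lambda>s. - f s" "\<lambda>s. - v s" u])
         (use that \<open>- v t > 0\<close> DERIV_minus[OF der] continuous_on_minus[OF cont] nz 2 \<open>t \<ge> t0\<close> in auto)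
    then have "?r \<le> f t"
      by (intro tendsto_upperbound[OF lim] eventually_at_top_linorderI) auto
    with 2 show False
      by simp
  qed
qed

end

section \<open>Existence of solutions up to prescribed radii\<close>

text \<open>In terms of the rapidity \<open>\<theta>\<close>, with \<open>v = tanh \<theta>\<close>, the equation is the system
\<open>f' = tanh \<theta>\<close>, \<open>\<theta>' = (d + 1) / cosh \<theta> - d / f\<close>. It becomes globally Lipschitz as soon as the
last term is cut off below a radius \<open>\<epsilon>\<close>.\<close>
lemma cutoff_inverse_lipschitz:
  fixes \<epsilon> :: real
  assumes "\<epsilon> > 0"
  shows "(1 / \<epsilon>\<^sup>2)-lipschitz_on UNIV (\<lambda>x. 1 / max x \<epsilon>)"
proof (rule lipschitz_onI)
  fix x y :: real
  define a b where "a = max x \<epsilon>" and "b = max y \<epsilon>"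
  have a: "a \<ge> \<epsilon>" and b: "b \<ge> \<epsilon>"
    by (auto simp: a_def b_def)
  have "\<bar>1 / a - 1 / b\<bar> = \<bar>a - b\<bar> / (a * b)"
    using a b assms by (simp add: field_simps abs_mult abs_minus_commute)
  also have "\<dots> \<le> \<bar>a - b\<bar> / \<epsilon>\<^sup>2"
    unfolding power2_eq_square
    using a b assms by (intro divide_left_mono mult_mono mult_pos_pos) auto
  also have "\<dots> \<le> \<bar>x - y\<bar> / \<epsilon>\<^sup>2"
    by (intro divide_right_mono) (auto simp: a_def b_def)
  finally show "dist (1 / max x \<epsilon>) (1 / max y \<epsilon>) \<le> 1 / \<epsilon>\<^sup>2 * dist x y"
    by (simp add: dist_real_def a_def b_def)
qed simp

lemma tanh_lipschitz: "1-lipschitz_on UNIV (tanh :: real \<Rightarrow> real)"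
proof (rule bounded_derivative_imp_lipschitz)
  fix x :: real
  have "(tanh has_real_derivative 1 - tanh x ^ 2) (at x)"
    using cosh_real_pos[of x] by (auto intro!: derivative_eq_intros)
  then show "(tanh has_derivative (\<lambda>h. h * (1 - tanh x ^ 2))) (at x within UNIV)"
    by (simp add: has_field_derivative_def mult_commute_abs)
  show "onorm (\<lambda>h. h * (1 - tanh x ^ 2)) \<le> 1"
  proof (rule onorm_bound)
    show "norm (h * (1 - tanh x ^ 2)) \<le> 1 * norm h" for h
      using tanh_real_bounds[of x]
      by (simp add: abs_mult mult_left_le abs_square_le_1 abs_le_iff less_imp_le)
  qed simp
qed auto

lemma inverse_cosh_lipschitz: "1-lipschitz_on UNIV (\<lambda>x :: real. inverse (cosh x))"
proof (rule bounded_derivative_imp_lipschitz)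
  fix x :: real
  have [simp]: "cosh x \<noteq> 0"
    using cosh_real_pos[of x] by simp
  show "((\<lambda>x. inverse (cosh x)) has_derivative (\<lambda>h. h * - (tanh x * inverse (cosh x)))) (at x within UNIV)"
    by (auto intro!: derivative_eq_intros simp: tanh_def field_simps power2_eq_square)
  show "onorm (\<lambda>h. h * - (tanh x * inverse (cosh x))) \<le> 1"
  proof (rule onorm_bound)
    fix h :: real
    have "\<bar>tanh x\<bar> \<le> 1" "\<bar>inverse (cosh x)\<bar> \<le> 1"
      using tanh_real_bounds[of x] cosh_real_ge_1[of x] by (auto simp: abs_le_iff less_imp_le inverse_le_1_iff)
    then have "\<bar>tanh x * inverse (cosh x)\<bar> \<le> 1"
      unfolding abs_mult by (rule mult_le_one[OF _ abs_ge_zero])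
    then show "norm (h * - (tanh x * inverse (cosh x))) \<le> 1 * norm h"
      by (simp add: abs_mult mult_left_le)
  qed simp
qed auto

lemma rapidity_identities:
  fixes \<theta> :: real
  shows "\<bar>tanh \<theta>\<bar> < 1" "1 - (tanh \<theta>)\<^sup>2 = (inverse (cosh \<theta>))\<^sup>2"
proof -
  have c: "cosh \<theta> > 0"
    by (rule cosh_real_pos)
  show "\<bar>tanh \<theta>\<bar> < 1"
    using tanh_real_bounds[of \<theta>] by (simp add: abs_less_iff)
  have "1 - (tanh \<theta>)\<^sup>2 = ((cosh \<theta>)\<^sup>2 - (sinh \<theta>)\<^sup>2) / (cosh \<theta>)\<^sup>2"
    using c by (simp add: tanh_def power_divide diff_divide_distrib)
  also have "(cosh \<theta>)\<^sup>2 - (sinh \<theta>)\<^sup>2 = 1"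
    by (simp add: cosh_square_eq)
  finally show "1 - (tanh \<theta>)\<^sup>2 = (inverse (cosh \<theta>))\<^sup>2"
    by (simp add: power_inverse divide_inverse)
qed

lemma tanh_artanh: "tanh (artanh y) = y" if "\<bar>y\<bar> < 1" for y :: real
proof -
  have y: "1 + y > 0" "1 - y > 0"
    using that by auto
  have e: "exp (- 2 * artanh y) = (1 - y) / (1 + y)"
    using y by (simp add: artanh_def exp_minus)
  show ?thesis
    unfolding tanh_real_altdef e using y by (simp add: field_simps)
qed

text \<open>For arbitrary data, the solution of the system for \<open>(f, \<theta>)\<close> with cut-off at \<open>\<epsilon>\<close> is a genuine solution
as long as it stays above \<open>\<epsilon>\<close>. This serves the expanding solutions.\<close>
lemma solution_until_level_below:
  fixes x0 y0 \<epsilon> :: real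
  assumes "\<bar>y0\<bar> < 1" and \<epsilon>: "0 < \<epsilon>" "\<epsilon> < x0"
  obtains (global) g w where "g t0 = x0" "w t0 = y0" "cmc_solution d {t0..} g w"
  | (reached) g w \<tau> where "g t0 = x0" "w t0 = y0" "\<tau> > t0" "cmc_solution d {t0..\<tau>} g w" "g \<tau> = \<epsilon>"
proof -
  define F where "F = (\<lambda>p :: real \<times> real.
    (tanh (snd p), (real d + 1) * inverse (cosh (snd p)) - real d * (1 / max (fst p) \<epsilon>)))"
  have fst1: "1-lipschitz_on UNIV (fst :: real \<times> real \<Rightarrow> real)"
    by (rule lipschitz_onI) (auto simp: dist_fst_le)
  have snd1: "1-lipschitz_on UNIV (snd :: real \<times> real \<Rightarrow> real)"
    by (rule lipschitz_onI) (auto simp: dist_snd_le)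
  note comp = lipschitz_on_compose2[OF _ lipschitz_on_subset[OF _ subset_UNIV]]
  have "\<exists>L. L-lipschitz_on UNIV F"
    unfolding F_def
    by (rule exI, rule lipschitz_on_Pair[OF comp[OF snd1 tanh_lipschitz]
        lipschitz_on_diff[OF
          lipschitz_on_cmult_real[OF comp[OF snd1 inverse_cosh_lipschitz]]
          lipschitz_on_cmult_real[OF comp[OF fst1 cutoff_inverse_lipschitz[OF \<epsilon>(1)]]]]])
  then obtain L where "L-lipschitz_on UNIV F" ..
  from global_solution_of_lipschitz_field[OF this, of t0 "(x0, artanh y0)"]
  obtain p where p0: "p t0 = (x0, artanh y0)"
    and p: "\<And>t. t \<ge> t0 \<Longrightarrow> (p has_vector_derivative F (p t)) (at t within {t0..})"
    by auto
  define g \<theta> where "g t = fst (p t)" and "\<theta> t = snd (p t)" for t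
  have g: "(g has_real_derivative tanh (\<theta> t)) (at t within {t0..})" if "t \<ge> t0" for t
    using bounded_linear.has_vector_derivative[OF bounded_linear_fst p[OF that]]
    by (simp add: F_def g_def[abs_def] \<theta>_def has_real_derivative_iff_has_vector_derivative)
  have \<theta>: "(\<theta> has_real_derivative (real d + 1) * inverse (cosh (\<theta> t)) - real d * (1 / max (g t) \<epsilon>))
      (at t within {t0..})" if "t \<ge> t0" for t
    using bounded_linear.has_vector_derivative[OF bounded_linear_snd p[OF that]]
    by (simp add: F_def g_def \<theta>_def[abs_def] has_real_derivative_iff_has_vector_derivative)
  have cg: "continuous_on {t0..} g"
    using g by (auto intro!: DERIV_continuous_on)
  have cmc: "cmc_solution d J g (\<lambda>t. tanh (\<theta> t))" if J: "J \<subseteq> {t0..}" "\<And>t. t \<in> J \<Longrightarrow> g t \<ge> \<epsilon>" for J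
    unfolding cmc_solution_def
  proof (intro ballI conjI)
    fix t assume "t \<in> J"
    then have t: "t \<ge> t0" "g t \<ge> \<epsilon>"
      using J by auto
    then show gpos: "g t > 0"
      using \<epsilon> by simp
    show "\<bar>tanh (\<theta> t)\<bar> < 1"
      by (rule rapidity_identities)
    show "(g has_real_derivative tanh (\<theta> t)) (at t within J)"
      by (rule DERIV_subset[OF g[OF t(1)] J(1)])
    define s where "s = inverse (cosh (\<theta> t))"
    have s: "s > 0" "1 - (tanh (\<theta> t))\<^sup>2 = s\<^sup>2"
      using cosh_real_pos[of "\<theta> t"] rapidity_identities(2)[of "\<theta> t"] by (auto simp: s_def)
    have "((\<lambda>t. tanh (\<theta> t)) has_real_derivative s\<^sup>2 * ((real d + 1) * s - real d / g t)) (at t within J)"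
    proof -
      have "(\<theta> has_real_derivative (real d + 1) * s - real d / g t) (at t within J)"
        using DERIV_subset[OF \<theta>[OF t(1)] J(1)] t(2) by (simp add: s_def max_absorb1)
      then have "((\<lambda>t. tanh (\<theta> t)) has_real_derivative
          (1 - (tanh (\<theta> t))\<^sup>2) * ((real d + 1) * s - real d / g t)) (at t within J)"
        using cosh_real_pos[of "\<theta> t"] by (auto intro!: derivative_eq_intros)
      then show ?thesis
        by (simp only: s(2))
    qed
    moreover have "s\<^sup>2 * real d + g t * (s\<^sup>2 * ((real d + 1) * s - real d / g t))
        = (real d + 1) * s ^ 3 * g t"
      using gpos by (simp add: field_simps power2_eq_square power3_eq_cube)
    ultimately show "\<exists>a. ((\<lambda>t. tanh (\<theta> t)) has_real_derivative a) (at t within J) \<and>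
        (1 - (tanh (\<theta> t))\<^sup>2) * real d + g t * a
          = (real d + 1) * (1 - (tanh (\<theta> t))\<^sup>2) powr (3/2) * g t"
      unfolding s(2) powr_three_halves[OF s(1)] by blast
  qed
  have g0: "g t0 = x0" "tanh (\<theta> t0) = y0"
    using p0 assms(1) by (auto simp: g_def \<theta>_def tanh_artanh)
  show thesis
  proof (cases "\<forall>t\<ge>t0. g t \<ge> \<epsilon>")
    case True
    then have "cmc_solution d {t0..} g (\<lambda>t. tanh (\<theta> t))"
      by (intro cmc) auto
    then show thesis
      using g0 by (intro global[of g "\<lambda>t. tanh (\<theta> t)"]) auto
  next
    case False
    then obtain t where t: "t \<ge> t0" "g t < \<epsilon>"
      by force
    have "continuous_on {t0..t} (\<lambda>t. g t - \<epsilon>)"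
      by (intro continuous_intros continuous_on_subset[OF cg]) auto
    then obtain \<tau> where "t0 < \<tau>" "\<tau> \<le> t" "g \<tau> - \<epsilon> = 0" "\<And>s. t0 \<le> s \<Longrightarrow> s < \<tau> \<Longrightarrow> g s - \<epsilon> > 0"
      by (rule first_zero) (use t g0 \<epsilon> in auto)
    moreover from this have "cmc_solution d {t0..\<tau>} g (\<lambda>t. tanh (\<theta> t))"
      by (intro cmc) (auto simp: le_less)
    ultimately show thesis
      using g0 by (intro reached[of g "\<lambda>t. tanh (\<theta> t)"]) auto
  qed
qed

text \<open>For positive energy, Newton's equation on the energy level is regular down to and including radius \<open>0\<close>;
its field is only frozen outside the interval from \<open>0\<close> to \<open>A\<close>. Hence one solution covers the whole
life of a collapsing hypersurface, and its first zero is the time of collapse. The energy law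
\<open>v\<^sup>2 + (lapse d E f)\<^sup>2 = 1\<close> has to be recovered from the initial data before the equation follows.\<close>
lemma newton_solution_trichotomy:
  fixes x0 y0 E A :: real
  assumes d: "d \<ge> 1" and "x0 > 0" and "\<bar>y0\<bar> < 1" and E: "energy d x0 y0 = E" "E > 0" and A: "x0 < A"
  obtains (collapse) "collapses_in_finite_time d t0 (x0, y0)"
  | (reached) g w \<tau> where "g t0 = x0" "w t0 = y0" "\<tau> > t0" "cmc_solution d {t0..\<tau>} g w" "g \<tau> = A"
  | (global) g w where "g t0 = x0" "w t0 = y0" "cmc_solution d {t0..} g w"
proof -
  define G where "G x = - (lapse d E x * lapse_deriv d E x)" for x
  have den: "E + x ^ (d + 1) > 0" if "x \<ge> 0" for x
    using E(2) zero_le_power[OF that, of "d + 1"] by simp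
  have "(\<lambda>x :: real. x ^ n) C1_differentiable_on S" for n S
    by (intro C1_differentiable_on_power) simp
  note pow = this
  have "(\<lambda>x. inverse (E + x ^ (d + 1))) C1_differentiable_on {0..A}"
    using den by (intro C1_differentiable_on_inverse C1_differentiable_on_add pow) force+
  then have "G C1_differentiable_on {0..A}"
    unfolding G_def lapse_def lapse_deriv_def divide_inverse power_inverse[symmetric]
    by (intro C1_differentiable_on_minus C1_differentiable_on_mult C1_differentiable_on_diff
        C1_differentiable_on_power[of "\<lambda>x. inverse (E + x ^ (d + 1))"] pow C1_differentiable_on_const)
  then obtain L where L: "L-lipschitz_on {0..A} G"
    by (rule C1_imp_lipschitz_on_Icc)
  define clamp where "clamp x = max 0 (min A x)" for x
  have clamp: "clamp x \<in> {0..A}" for x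
    using A \<open>x0 > 0\<close> by (auto simp: clamp_def)
  have "L-lipschitz_on UNIV (\<lambda>p :: real \<times> real. G (clamp (fst p)))"
  proof (rule lipschitz_onI)
    fix p q :: "real \<times> real"
    have "dist (G (clamp (fst p))) (G (clamp (fst q))) \<le> L * dist (clamp (fst p)) (clamp (fst q))"
      by (rule lipschitz_onD[OF L clamp clamp])
    also have "\<dots> \<le> L * dist (fst p) (fst q)"
      using lipschitz_on_nonneg[OF L] by (intro mult_left_mono) (auto simp: clamp_def dist_real_def)
    also have "\<dots> \<le> L * dist p q"
      using lipschitz_on_nonneg[OF L] by (intro mult_left_mono dist_fst_le)
    finally show "dist (G (clamp (fst p))) (G (clamp (fst q))) \<le> L * dist p q" .
  qed (rule lipschitz_on_nonneg[OF L])
  moreover have "1-lipschitz_on UNIV (snd :: real \<times> real \<Rightarrow> real)"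
    by (rule lipschitz_onI) (auto simp: dist_snd_le)
  ultimately have "(sqrt (1\<^sup>2 + L\<^sup>2))-lipschitz_on UNIV (\<lambda>p :: real \<times> real. (snd p, G (clamp (fst p))))"
    by (intro lipschitz_on_Pair)
  from global_solution_of_lipschitz_field[OF this, of t0 "(x0, y0)"]
  obtain p where p0: "p t0 = (x0, y0)"
    and p: "\<And>t. t \<ge> t0 \<Longrightarrow> (p has_vector_derivative (snd (p t), G (clamp (fst (p t))))) (at t within {t0..})"
    by auto
  define f v where "f t = fst (p t)" and "v t = snd (p t)" for t
  have f: "(f has_real_derivative v t) (at t within {t0..})" if "t \<ge> t0" for t
    using bounded_linear.has_vector_derivative[OF bounded_linear_fst p[OF that]]
    by (simp add: f_def[abs_def] v_def has_real_derivative_iff_has_vector_derivative)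
  have v: "(v has_real_derivative G (clamp (f t))) (at t within {t0..})" if "t \<ge> t0" for t
    using bounded_linear.has_vector_derivative[OF bounded_linear_snd p[OF that]]
    by (simp add: f_def v_def[abs_def] has_real_derivative_iff_has_vector_derivative)
  have f0: "f t0 = x0" "v t0 = y0"
    using p0 by (auto simp: f_def v_def)
  have cf: "continuous_on {t0..} f"
    using f by (auto intro!: DERIV_continuous_on)
  have level: "(v t)\<^sup>2 + (lapse d E (f t))\<^sup>2 = 1"
    if "t \<ge> t0" and within: "\<And>s. s \<in> {t0..t} \<Longrightarrow> f s \<in> {0..A}" for t
  proof -
    have "((\<lambda>t. (v t)\<^sup>2 + (lapse d E (f t))\<^sup>2) has_real_derivative 0) (at s within {t0..t})"
      if s: "s \<in> {t0..t}" for s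
    proof -
      have fs: "f s \<in> {0..A}"
        by (rule within[OF s])
      then have "clamp (f s) = f s"
        by (simp add: clamp_def)
      then have "(v has_real_derivative G (f s)) (at s within {t0..t})"
        using DERIV_subset[OF v, of s "{t0..t}"] s by auto
      moreover have "(f has_real_derivative v s) (at s within {t0..t})"
        using DERIV_subset[OF f, of s "{t0..t}"] s by auto
      moreover have "(lapse d E has_real_derivative lapse_deriv d E (f s)) (at (f s))"
        using den[of "f s"] fs by (intro lapse_has_derivative[OF d]) auto
      ultimately show ?thesis
        by (auto intro!: derivative_eq_intros DERIV_chain2[of "lapse d E" _ f] simp: G_def)
    qed
    then obtain c where c: "\<And>s. s \<in> {t0..t} \<Longrightarrow> (v s)\<^sup>2 + (lapse d E (f s))\<^sup>2 = c"
      using has_field_derivative_zero_constant[OF convex_real_interval(5), of t0 t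
          "\<lambda>t. (v t)\<^sup>2 + (lapse d E (f t))\<^sup>2"] by blast
    show ?thesis
      using c[of t] c[of t0] \<open>t \<ge> t0\<close> energy_level(2)[OF \<open>x0 > 0\<close> \<open>\<bar>y0\<bar> < 1\<close> E(1)] f0 by simp
  qed
  have cmc: "cmc_solution d J f v"
    if J: "J \<subseteq> {t0..}" "\<And>t s. t \<in> J \<Longrightarrow> t0 \<le> s \<Longrightarrow> s \<le> t \<Longrightarrow> 0 < f s \<and> f s \<le> A" for J
    unfolding cmc_solution_def
  proof (intro ballI conjI)
    fix t assume "t \<in> J"
    then have t: "t \<ge> t0" "0 < f t" "f t \<le> A"
      using J by auto
    have lev: "(v t)\<^sup>2 + (lapse d E (f t))\<^sup>2 = 1"
      using J(2)[OF \<open>t \<in> J\<close>] by (intro level t(1)) (auto simp: less_imp_le)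
    have denf: "E + f t ^ (d + 1) > 0"
      using den t(2) by simp
    show "f t > 0" by fact
    show "\<bar>v t\<bar> < 1"
      by (rule subluminal_on_level[OF t(2) denf lev])
    show "(f has_real_derivative v t) (at t within J)"
      by (rule DERIV_subset[OF f[OF t(1)] J(1)])
    have "clamp (f t) = f t"
      using t by (simp add: clamp_def)
    then have "(v has_real_derivative - (lapse d E (f t) * lapse_deriv d E (f t))) (at t within J)"
      using DERIV_subset[OF v[OF t(1)] J(1)] by (simp add: G_def)
    then show "\<exists>a. (v has_real_derivative a) (at t within J) \<and>
        (1 - (v t)\<^sup>2) * real d + f t * a = (real d + 1) * (1 - (v t)\<^sup>2) powr (3/2) * f t"
      using newton_imp_cmc[OF d t(2) denf lev] by blast
  qed
  show thesis
  proof (cases "\<forall>t\<ge>t0. 0 < f t \<and> f t < A")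
    case True
    then have "cmc_solution d {t0..} f v"
      by (intro cmc) (auto simp: less_imp_le)
    with f0 show thesis
      by (rule global)
  next
    case False
    then obtain t where "t \<ge> t0" "\<not> (0 < f t \<and> f t < A)"
      by blast
    then have t: "t \<ge> t0" "min (f t) (A - f t) \<le> 0"
      by (auto simp: min_def)
    have "continuous_on {t0..t} (\<lambda>t. min (f t) (A - f t))"
      by (intro continuous_intros continuous_on_subset[OF cf]) auto
    then obtain \<tau> where \<tau>: "t0 < \<tau>" "min (f \<tau>) (A - f \<tau>) = 0"
        "\<And>s. t0 \<le> s \<Longrightarrow> s < \<tau> \<Longrightarrow> min (f s) (A - f s) > 0"
      by (rule first_zero) (use t f0 A \<open>x0 > 0\<close> in auto)
    have inside: "0 < f s" "f s < A" if "t0 \<le> s" "s < \<tau>" for s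
      using \<tau>(3)[OF that] by auto
    consider "f \<tau> = 0" | "f \<tau> = A"
      using \<tau>(2) by (auto simp: min_def split: if_splits)
    then show thesis
    proof cases
      case 1
      have "cmc_solution d {t0..<\<tau>} f v"
        using inside by (intro cmc) (auto simp: less_imp_le)
      moreover have "(f \<longlongrightarrow> 0) (at_left \<tau>)"
      proof -
        have "(f \<longlongrightarrow> f \<tau>) (at \<tau> within {t0..})"
          using cf \<tau>(1) by (simp add: continuous_on_def)
        then have "(f \<longlongrightarrow> f \<tau>) (at \<tau> within {t0..<\<tau>})"
          by (rule tendsto_within_subset) auto
        moreover have "at \<tau> within {t0..<\<tau>} = at_left \<tau>"
          by (rule at_within_nhd[of _ "{t0<..}"]) (use \<tau>(1) in auto)
        ultimately show ?thesis
          using 1 by simp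
      qed
      ultimately show thesis
        using \<tau>(1) f0 by (intro collapse) (auto simp: collapses_in_finite_time_def)
    next
      case 2
      have "0 < f s \<and> f s \<le> A" if "t0 \<le> s" "s \<le> \<tau>" for s
        using inside[of s] that 2 A \<open>x0 > 0\<close> by (cases "s = \<tau>") auto
      then have "cmc_solution d {t0..\<tau>} f v"
        by (intro cmc) auto
      with f0 \<tau>(1) show thesis
        using 2 by (rule reached)
    qed
  qed
qed

section \<open>Solutions off the stable branch\<close>
lemma cmc_acceleration:
  assumes d: "d \<ge> 1" and sol: "cmc_solution d I f v" and t: "t \<in> I" and E: "energy d (f t) (v t) = E"
  shows "(v has_real_derivative - (lapse d E (f t) * lapse_deriv d E (f t))) (at t within I)"
proof -
  obtain a where a: "(v has_real_derivative a) (at t within I)"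
    and eq: "(1 - (v t)\<^sup>2) * real d + f t * a = (real d + 1) * (1 - (v t)\<^sup>2) powr (3/2) * f t"
    using sol t unfolding cmc_solution_def by blast
  note f = cmc_solutionD[OF sol]
  have "(1 - (v t)\<^sup>2) * real d + f t * - (lapse d E (f t) * lapse_deriv d E (f t))
      = (real d + 1) * (1 - (v t)\<^sup>2) powr (3/2) * f t"
    using energy_level[OF f(1)[OF t] f(2)[OF t] E] by (intro newton_imp_cmc[OF d f(1)[OF t]])
  with eq have "f t * a = f t * - (lapse d E (f t) * lapse_deriv d E (f t))"
    by linarith
  then have "a = - (lapse d E (f t) * lapse_deriv d E (f t))"
    using f(1)[OF t] mult_left_cancel[of "f t" a] by (metis less_irrefl)
  with a show ?thesis
    by simp
qed

lemma allowed_denominator_pos: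
  assumes "potential d x < E" and "x \<ge> 0"
  shows "E + x ^ (d + 1) > 0"
  using assms zero_le_power[OF \<open>x \<ge> 0\<close>, of d] unfolding potential_def by linarith

lemma allowed_lapse:
  assumes d: "d \<ge> 1" and S: "S \<subseteq> {0..}" "\<And>x. x \<in> S \<Longrightarrow> potential d x < E"
  shows "continuous_on S (\<lambda>x. 1 - (lapse d E x)\<^sup>2)"
    and "x \<in> S \<Longrightarrow> 1 - (lapse d E x)\<^sup>2 > 0"
proof -
  have den: "E + x ^ (d + 1) > 0" if "x \<in> S" for x
    using allowed_denominator_pos S that by auto
  show "continuous_on S (\<lambda>x. 1 - (lapse d E x)\<^sup>2)"
    unfolding lapse_def using den by (intro continuous_intros) force
  show "x \<in> S \<Longrightarrow> 1 - (lapse d E x)\<^sup>2 > 0"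
    using lapse_less_one_iff[OF d] den[of x] S by auto
qed

lemma speed_squared:
  assumes "cmc_solution d I f v" and "t \<in> I" and "energy d (f t) (v t) = E"
  shows "(v t)\<^sup>2 = 1 - (lapse d E (f t))\<^sup>2"
  using energy_level(2)[OF cmc_solutionD(1,2)[OF assms(1,2)] assms(3)] assms(2) by simp

lemma moving_where_allowed:
  assumes d: "d \<ge> 1" and "cmc_solution d I f v" and "t \<in> I" and "energy d (f t) (v t) = E"
    and "potential d (f t) < E"
  shows "v t \<noteq> 0"
  using energy_eq_potential_iff[OF d cmc_solutionD(1,2)[OF assms(2,3)]] assms by auto

text \<open>If the potential stays below the energy from \<open>f a\<close> on, there is no point of rest ahead, and the
energy law \<open>v\<^sup>2 = 1 - (lapse d E f)\<^sup>2\<close> drives \<open>f\<close> past every radius.\<close>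
lemma rising_solution_expands:
  assumes d: "d \<ge> 1" and sol: "cmc_solution d {a..} f v" and "v a > 0"
    and allowed: "\<And>x. x \<ge> f a \<Longrightarrow> potential d x < energy d (f a) (v a)"
  shows "filterlim f at_top at_top"
proof -
  define E where "E = energy d (f a) (v a)"
  have E: "energy d (f t) (v t) = E" if "t \<ge> a" for t
    unfolding E_def using that by (intro energy_conserved[OF sol]) auto
  have "f a > 0"
    using cmc_solutionD(1)[OF sol] by simp
  then have *: "{f a..} \<subseteq> {0..}" "\<And>x. x \<in> {f a..} \<Longrightarrow> potential d x < E"
    using allowed by (auto simp: E_def)
  show ?thesis
  proof (rule grows_to_infinity[where W = "\<lambda>x. 1 - (lapse d E x)\<^sup>2"])
    show "(f has_real_derivative v t) (at t within {a..})" if "t \<ge> a" for t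
      using cmc_solutionD(3)[OF sol] that by simp
    show "(v t)\<^sup>2 = 1 - (lapse d E (f t))\<^sup>2" if "t \<ge> a" for t
      using that E by (intro speed_squared[OF sol]) auto
    show "1 - (lapse d E x)\<^sup>2 > 0" if "x \<ge> f a" for x
      using allowed_lapse(2)[OF d *, of x] that by simp
  qed (use \<open>v a > 0\<close> cmc_solutionD(4)[OF sol] allowed_lapse(1)[OF d *] in simp_all)
qed

text \<open>The mirror image: with no point of rest between \<open>0\<close> and \<open>f a\<close>, the solution would reach \<open>0\<close> in finite
time, where a solution of the equation cannot exist.\<close>
lemma falling_solution_not_global:
  assumes d: "d \<ge> 1" and sol: "cmc_solution d {a..} f v" and "v a < 0"
    and allowed: "\<And>x. 0 \<le> x \<Longrightarrow> x \<le> f a \<Longrightarrow> potential d x < energy d (f a) (v a)"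
  shows False
proof -
  define E where "E = energy d (f a) (v a)"
  have E: "energy d (f t) (v t) = E" if "t \<ge> a" for t
    unfolding E_def using that by (intro energy_conserved[OF sol]) auto
  have *: "{0..f a} \<subseteq> {0..}" "\<And>x. x \<in> {0..f a} \<Longrightarrow> potential d x < E"
    using allowed by (auto simp: E_def)
  have "\<exists>t\<ge>a. - f t \<ge> 0"
  proof (rule reaches_level[where W = "\<lambda>x. 1 - (lapse d E (- x))\<^sup>2"])
    show "((\<lambda>t. - f t) has_real_derivative - v t) (at t within {a..})" if "t \<ge> a" for t
      using DERIV_minus[OF cmc_solutionD(3)[OF sol]] that by simp
    show "continuous_on {a..} (\<lambda>t. - v t)"
      by (rule continuous_on_minus[OF cmc_solutionD(4)[OF sol]])
    show "- v a > 0"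
      using \<open>v a < 0\<close> by simp
    show "(- v t)\<^sup>2 = 1 - (lapse d E (- (- f t)))\<^sup>2" if "t \<ge> a" for t
      using that E speed_squared[OF sol, of t E] by simp
    show "1 - (lapse d E (- x))\<^sup>2 > 0" if "x \<in> {- f a..0}" for x
      using allowed_lapse(2)[OF d *, of "- x"] that by auto
    show "continuous_on {- f a..0} (\<lambda>x. 1 - (lapse d E (- x))\<^sup>2)"
      by (rule continuous_on_compose2[OF allowed_lapse(1)[OF d *] continuous_on_minus[OF continuous_on_id]]) auto
  qed
  then obtain t where "t \<ge> a" "- f t \<ge> 0"
    by blast
  then show False
    using cmc_solutionD(1)[OF sol, of t] by simp
qed

text \<open>At the equilibrium radius the energy is at least critical, so a subcritical solution cannot pass it.\<close>
lemma solution_keeps_side: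
  assumes d: "d \<ge> 1" and sol: "cmc_solution d {a..b} f v" and "a \<le> b"
    and E: "energy d (f a) (v a) < critical_energy d"
  shows "f a > equilibrium d \<Longrightarrow> f b > equilibrium d"
    and "f a < equilibrium d \<Longrightarrow> f b < equilibrium d"
proof -
  have avoid: "f t \<noteq> equilibrium d" if "t \<in> {a..b}" for t
  proof
    assume "f t = equilibrium d"
    then have "critical_energy d \<le> energy d (f t) (v t)"
      using energy_ge_potential[OF d cmc_solutionD(1,2)[OF sol that]] by simp
    also have "\<dots> = energy d (f a) (v a)"
      using that by (intro energy_conserved[OF sol]) auto
    finally show False
      using E by simp
  qed
  note cont = cmc_solutionD(5)[OF sol]
  show "f b > equilibrium d" if "f a > equilibrium d"
    using IVT2'[of f b "equilibrium d" a] that avoid cont \<open>a \<le> b\<close> by force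
  show "f b < equilibrium d" if "f a < equilibrium d"
    using IVT'[of f a "equilibrium d" b] that avoid cont \<open>a \<le> b\<close> by force
qed

text \<open>Outside the equilibrium and below the critical energy, the acceleration is positive, since its sign is
that of \<open>f ^ (d + 1) - d E\<close> and \<open>d E < d * critical_energy d = r ^ (d + 1)\<close>. If \<open>f\<close> kept falling it would stay between
\<open>r\<close> and \<open>f a\<close>, where the acceleration is bounded below by the constant \<open>c\<close>, and the velocity would
become positive. The energy may be negative here, so the denominator \<open>E + f ^ (d + 1)\<close> is controlled
along the solution only.\<close>
lemma subcritical_outside_turns:
  assumes d: "d \<ge> 1" and sol: "cmc_solution d {a..} f v"
    and E: "energy d (f a) (v a) < critical_energy d" and fa: "f a > equilibrium d"
  shows "\<exists>t\<ge>a. v t > 0"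
proof (rule ccontr)
  assume "\<not> ?thesis"
  then have v: "v t \<le> 0" if "t \<ge> a" for t
    using that by force
  define E where "E = energy d (f a) (v a)"
  define r where "r = equilibrium d"
  have r: "r > 0"
    using equilibrium_bounds[OF d] by (simp add: r_def)
  note f = cmc_solutionD[OF sol]
  have en: "energy d (f t) (v t) = E" if "t \<ge> a" for t
    unfolding E_def using that by (intro energy_conserved[OF sol]) auto
  have lower: "f t > r" if "t \<ge> a" for t
    unfolding r_def
    by (rule solution_keeps_side(1)[OF d cmc_solution_subset[OF sol] that E fa]) auto
  have upper: "f t \<le> f a" if "t \<ge> a" for t
    using increment_ge[OF that, of "\<lambda>t. - f t" "\<lambda>t. - v t" 0] v DERIV_minus[OF DERIV_subset[OF f(3)]]
    by force
  define D where "D = E + f a ^ (d + 1)"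
  define m where "m = r ^ (d + 1) - real d * E"
  have "real d * E < real d * critical_energy d"
    using E d by (intro mult_strict_left_mono) (auto simp: E_def)
  then have m: "m > 0"
    using critical_energy_eq[OF d] by (simp add: m_def r_def)
  have D: "D > 0"
    using energy_level(1)[OF f(1,2) en, of a] by (simp add: D_def)
  define c where "c = r ^ d / D * (r ^ (d - 1) * m / D\<^sup>2)"
  have c: "c > 0"
    using r m D by (simp add: c_def)
  have acc: "- (lapse d E (f t) * lapse_deriv d E (f t)) \<ge> c" if "t \<ge> a" for t
  proof -
    have x: "r \<le> f t" "0 < f t" "f t \<le> f a"
      using lower[OF that] r upper[OF that] by auto
    have D1: "0 < E + f t ^ (d + 1)"
      using energy_level(1)[OF f(1,2) en[OF that]] that by simp
    have D2: "E + f t ^ (d + 1) \<le> D"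
      unfolding D_def using x by (intro add_left_mono power_mono) auto
    have m': "m \<le> f t ^ (d + 1) - real d * E"
      unfolding m_def using x r by (intro diff_right_mono power_mono) auto
    have "r ^ d / D \<le> lapse d E (f t)"
      unfolding lapse_def using x r D1 D2 D by (intro frac_le power_mono) auto
    moreover have "r ^ (d - 1) * m / D\<^sup>2 \<le> f t ^ (d - 1) * (f t ^ (d + 1) - real d * E) / (E + f t ^ (d + 1))\<^sup>2"
      using x r D1 D2 D m m' by (intro frac_le mult_mono power_mono) (auto intro!: mult_nonneg_nonneg)
    ultimately have "c \<le> lapse d E (f t) * (f t ^ (d - 1) * (f t ^ (d + 1) - real d * E) / (E + f t ^ (d + 1))\<^sup>2)"
      unfolding c_def using r D m x D1 by (intro mult_mono) (auto simp: lapse_def)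
    also have "\<dots> = - (lapse d E (f t) * lapse_deriv d E (f t))"
    proof -
      have "lapse_deriv d E (f t) =
          - (f t ^ (d - 1) * (f t ^ (d + 1) - real d * E) / (E + f t ^ (d + 1))\<^sup>2)"
        unfolding lapse_deriv_def by (metis minus_diff_eq minus_divide_left mult_minus_right)
      then show ?thesis
        by simp
    qed
    finally show ?thesis .
  qed
  \<comment> \<open>At this time the velocity would be at least \<open>1\<close>.\<close>
  define t where "t = a + (1 - v a) / c"
  have "t \<ge> a"
    using c v[of a] by (simp add: t_def)
  then have "v t - v a \<ge> (t - a) * c"
  proof (rule increment_ge[where v = "\<lambda>t. - (lapse d E (f t) * lapse_deriv d E (f t))"])
    show "(v has_real_derivative - (lapse d E (f s) * lapse_deriv d E (f s))) (at s within {a..t})"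
      if "s \<in> {a..t}" for s
      using cmc_acceleration[OF d sol _ en, of s] that by (auto elim: DERIV_subset)
    show "c \<le> - (lapse d E (f s) * lapse_deriv d E (f s))" if "a < s" for s
      using that by (intro acc) simp
  qed
  then show False
    using v[OF \<open>t \<ge> a\<close>] c by (simp add: t_def)
qed

text \<open>Inside the equilibrium, \<open>d E - f ^ (d + 1)\<close> is positive wherever the potential is at most \<open>E\<close>, because
\<open>d * potential d x - x ^ (d + 1) = x ^ d (d - (d + 1) x)\<close>. If \<open>f\<close> kept rising it would stay in the compact
set \<open>K\<close> of such radii between \<open>f a\<close> and the equilibrium, on which the deceleration \<open>G\<close> has a positive minimum.\<close>
lemma subcritical_inside_turns:
  assumes d: "d \<ge> 1" and sol: "cmc_solution d {a..} f v"
    and E: "energy d (f a) (v a) < critical_energy d" and fa: "f a < equilibrium d"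
  shows "\<exists>t\<ge>a. v t < 0"
proof (rule ccontr)
  assume "\<not> ?thesis"
  then have v: "v t \<ge> 0" if "t \<ge> a" for t
    using that by force
  define E where "E = energy d (f a) (v a)"
  define r where "r = equilibrium d"
  have r: "r > 0" "(real d + 1) * r = real d" "r < 1"
    using equilibrium_bounds[OF d] by (auto simp: r_def equilibrium_def)
  note f = cmc_solutionD[OF sol]
  have f_pos: "f t > 0" if "t \<ge> a" for t
    using f(1) that by simp
  have en: "energy d (f t) (v t) = E" if "t \<ge> a" for t
    unfolding E_def using that by (intro energy_conserved[OF sol]) auto
  have upper: "f t < r" if "t \<ge> a" for t
    unfolding r_def
    by (rule solution_keeps_side(2)[OF d cmc_solution_subset[OF sol] that E fa]) auto
  have lower: "f t \<ge> f a" if "t \<ge> a" for t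
    using increment_ge[OF that, of f v 0] v DERIV_subset[OF f(3)] by force
  have pot: "potential d (f t) \<le> E" if "t \<ge> a" for t
    using energy_ge_potential[OF d f(1,2), of t t] en[OF that] that by simp
  have E_pos: "E > 0"
  proof -
    have "0 < f a ^ d * (1 - f a)"
      using f_pos[of a] upper[of a] r by simp
    also have "\<dots> = potential d (f a)"
      by (simp add: potential_def algebra_simps)
    finally show ?thesis
      using pot[of a] by simp
  qed
  define K where "K = {x \<in> {f a..r}. potential d x \<le> E}"
  have cpot: "continuous_on S (potential d)" for S
    unfolding potential_def[abs_def] by (intro continuous_intros)
  have "closed ({f a..r} \<inter> potential d -` {..E})"
    by (intro continuous_closed_preimage cpot) auto
  moreover have "{f a..r} \<inter> potential d -` {..E} = K"
    by (auto simp: K_def)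
  ultimately have "closed K"
    by simp
  moreover have "K \<subseteq> {f a..r}"
    by (auto simp: K_def)
  ultimately have "compact K"
    using bounded_subset[OF bounded_closed_interval] by (auto simp: compact_eq_bounded_closed)
  define G where "G x = lapse d E x * lapse_deriv d E x" for x
  have K: "x > 0" "E + x ^ (d + 1) > 0" "G x > 0" if "x \<in> K" for x
  proof -
    show x: "x > 0"
      using that f_pos[of a] by (simp add: K_def)
    then show D: "E + x ^ (d + 1) > 0"
      using E_pos by (simp add: add_pos_pos)
    have "x \<noteq> r"
      using that E by (auto simp: K_def r_def E_def)
    then have "x < r"
      using that by (simp add: K_def)
    then have "(real d + 1) * x < real d"
      using mult_strict_left_mono[of x r "real d + 1"] r(2) by simp
    then have "0 < x ^ d * (real d - (real d + 1) * x)"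
      using x by simp
    also have "\<dots> = real d * potential d x - x ^ (d + 1)"
      by (simp add: potential_def algebra_simps)
    also have "\<dots> \<le> real d * E - x ^ (d + 1)"
      using that by (intro diff_right_mono mult_left_mono) (auto simp: K_def)
    finally show "G x > 0"
      using x D by (simp add: G_def lapse_def lapse_deriv_def)
  qed
  have inK: "f t \<in> K" if "t \<ge> a" for t
    using lower upper pot that by (auto simp: K_def less_imp_le)
  have "continuous_on K G"
    unfolding G_def lapse_def lapse_deriv_def using K by (intro continuous_intros) force+
  then obtain x where x: "x \<in> K" "\<And>y. y \<in> K \<Longrightarrow> G x \<le> G y"
    using continuous_attains_inf[OF \<open>compact K\<close>, of G] inK[of a] by force
  have gx: "G x > 0"
    by (rule K(3)[OF x(1)])
  \<comment> \<open>At this time the velocity would be at most \<open>- 1\<close>.\<close>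
  define t where "t = a + (1 + v a) / G x"
  have "t \<ge> a"
    using gx v[of a] by (simp add: t_def)
  then have "- v t - - v a \<ge> (t - a) * G x"
  proof (rule increment_ge[where v = "\<lambda>t. G (f t)"])
    show "((\<lambda>t. - v t) has_real_derivative G (f s)) (at s within {a..t})" if "s \<in> {a..t}" for s
      using DERIV_minus[OF cmc_acceleration[OF d sol _ en, of s]] that
      by (auto simp: G_def elim: DERIV_subset)
    show "G x \<le> G (f s)" if "a < s" for s
      using that by (intro x(2) inK) simp
  qed
  then show False
    using v[OF \<open>t \<ge> a\<close>] gx by (simp add: t_def)
qed

text \<open>Either the data rise with no point of rest ahead, or they lie outside the barrier; in both cases the
solution never comes down to the radius \<open>\<epsilon>\<close>, hence it is global, and after a possible turn it rises
with no point of rest ahead.\<close>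
lemma expands_if:
  assumes d: "d \<ge> 1" and x0: "x0 > 0" and y0: "\<bar>y0\<bar> < 1"
    and cases: "(y0 > 0 \<and> (\<forall>x\<ge>x0. potential d x < energy d x0 y0)) \<or>
      (x0 > equilibrium d \<and> energy d x0 y0 < critical_energy d)"
  shows "expands_indefinitely d t0 (x0, y0)"
proof -
  define \<epsilon> where "\<epsilon> = min x0 (equilibrium d) / 2"
  have \<epsilon>: "0 < \<epsilon>" "\<epsilon> < x0" "\<epsilon> < equilibrium d"
    using x0 equilibrium_bounds[OF d] by (auto simp: \<epsilon>_def)
  from y0 \<epsilon>(1,2) show ?thesis
  proof (cases rule: solution_until_level_below[of y0 \<epsilon> x0 t0 d])
    case (global g w)
    have "filterlim g at_top at_top"
      using cases
    proof
      assume "y0 > 0 \<and> (\<forall>x\<ge>x0. potential d x < energy d x0 y0)"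
      then show ?thesis
        using global by (intro rising_solution_expands[OF d global(3)]) auto
    next
      assume out: "x0 > equilibrium d \<and> energy d x0 y0 < critical_energy d"
      then obtain t1 where t1: "t1 \<ge> t0" "w t1 > 0"
        using subcritical_outside_turns[OF d global(3)] global by auto
      have side: "g t1 > equilibrium d"
        by (rule solution_keeps_side(1)[OF d cmc_solution_subset[OF global(3)] t1(1)])
           (use out global in auto)
      have dat: "g t1 > 0" "\<bar>w t1\<bar> < 1"
        using cmc_solutionD(1,2)[OF global(3), of t1] t1(1) by simp_all
      show ?thesis
      proof (rule rising_solution_expands[OF d cmc_solution_subset[OF global(3)] t1(2)])
        show "{t1..} \<subseteq> {t0..}"
          using t1 by auto
        show "potential d x < energy d (g t1) (w t1)" if "x \<ge> g t1" for x
        proof -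
          have "potential d x \<le> potential d (g t1)"
            using side that by (intro potential_antimono[OF d]) auto
          also have "\<dots> < energy d (g t1) (w t1)"
            using energy_ge_potential[OF d dat] energy_eq_potential_iff[OF d dat] t1(2) by auto
          finally show ?thesis .
        qed
      qed
    qed
    with global show ?thesis
      unfolding expands_indefinitely_def by blast
  next
    case (reached g w \<tau>)
    have "g \<tau> > \<epsilon>"
      using cases
    proof
      assume up: "y0 > 0 \<and> (\<forall>x\<ge>x0. potential d x < energy d x0 y0)"
      have "g t0 \<le> g \<tau>"
      proof (rule no_turning(2)[of t0 \<tau> g w])
        show "w t \<noteq> 0" if "t \<in> {t0..\<tau>}" "g t0 \<le> g t" for t
        proof (rule moving_where_allowed[OF d reached(4) that(1) refl])
          have "energy d (g t) (w t) = energy d x0 y0"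
            using energy_conserved[OF reached(4), of t t0] that reached by auto
          then show "potential d (g t) < energy d (g t) (w t)"
            using up that reached by auto
        qed
      qed (use cmc_solutionD[OF reached(4)] reached up in auto)
      then show ?thesis
        using \<epsilon> reached by simp
    next
      assume "x0 > equilibrium d \<and> energy d x0 y0 < critical_energy d"
      then show ?thesis
        using solution_keeps_side(1)[OF d reached(4)] reached \<epsilon> by force
    qed
    with reached show ?thesis
      by simp
  qed
qed

text \<open>Either the data fall with no point of rest ahead, or they lie inside the barrier. In both cases \<open>A\<close> is a
radius out of reach, and a global solution would, after a possible turn, fall with no point of rest
ahead; only the collapse is left.\<close>
lemma collapses_if:
  assumes d: "d \<ge> 1" and x0: "x0 > 0" and y0: "\<bar>y0\<bar> < 1"
    and cases: "(y0 < 0 \<and> (\<forall>x. 0 \<le> x \<longrightarrow> x \<le> x0 \<longrightarrow> potential d x < energy d x0 y0)) \<or>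
      (x0 < equilibrium d \<and> energy d x0 y0 < critical_energy d)"
  shows "collapses_in_finite_time d t0 (x0, y0)"
proof -
  \<comment> \<open>Falling data do not rise above \<open>x0\<close>, so there any larger radius does.\<close>
  define A where "A = (if x0 < equilibrium d \<and> energy d x0 y0 < critical_energy d then equilibrium d else x0 + 1)"
  have A: "x0 < A"
    by (auto simp: A_def)
  have pot0: "potential d 0 = 0"
    using d by (simp add: potential_def)
  have E: "energy d x0 y0 > 0"
    using cases
  proof
    assume "x0 < equilibrium d \<and> energy d x0 y0 < critical_energy d"
    then have "0 < x0 ^ d * (1 - x0)"
      using x0 equilibrium_bounds[OF d] by simp
    also have "\<dots> = potential d x0"
      by (simp add: potential_def algebra_simps)
    also have "\<dots> \<le> energy d x0 y0"
      by (rule energy_ge_potential[OF d x0 y0])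
    finally show ?thesis .
  qed (use pot0 x0 in force)
  from d x0 y0 refl E A show ?thesis
  proof (cases rule: newton_solution_trichotomy[of d x0 y0 "energy d x0 y0" A t0])
    case collapse
    then show ?thesis .
  next
    case (reached g w \<tau>)
    have "g \<tau> < A"
    proof (cases "x0 < equilibrium d \<and> energy d x0 y0 < critical_energy d")
      case True
      then show ?thesis
        using solution_keeps_side(2)[OF d reached(4)] reached by (simp add: A_def)
    next
      case False
      then have down: "y0 < 0" "\<And>x. 0 \<le> x \<Longrightarrow> x \<le> x0 \<Longrightarrow> potential d x < energy d x0 y0"
        using cases by auto
      have "- g t0 \<le> - g \<tau>"
      proof (rule no_turning(2)[of t0 \<tau> "\<lambda>t. - g t" "\<lambda>t. - w t"])
        show "((\<lambda>t. - g t) has_real_derivative - w t) (at t within {t0..\<tau>})" if "t \<in> {t0..\<tau>}" for t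
          by (rule DERIV_minus[OF cmc_solutionD(3)[OF reached(4) that]])
        show "continuous_on {t0..\<tau>} (\<lambda>t. - w t)"
          by (rule continuous_on_minus[OF cmc_solutionD(4)[OF reached(4)]])
        show "- w t \<noteq> 0" if "t \<in> {t0..\<tau>}" "- g t0 \<le> - g t" for t
        proof -
          have "energy d (g t) (w t) = energy d x0 y0"
            using energy_conserved[OF reached(4), of t t0] that reached by auto
          then have "potential d (g t) < energy d (g t) (w t)"
            using down(2)[of "g t"] that reached(1) cmc_solutionD(1)[OF reached(4) that(1)] by simp
          then show ?thesis
            using moving_where_allowed[OF d reached(4) that(1) refl] by simp
        qed
      qed (use reached down in auto)
      then show ?thesis
        using A reached by simp
    qed
    with reached show ?thesis
      by simp
  next
    case (global g w)
    have False
      using cases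
    proof
      assume "y0 < 0 \<and> (\<forall>x. 0 \<le> x \<longrightarrow> x \<le> x0 \<longrightarrow> potential d x < energy d x0 y0)"
      then show False
        using global by (intro falling_solution_not_global[OF d global(3)]) auto
    next
      assume inside: "x0 < equilibrium d \<and> energy d x0 y0 < critical_energy d"
      then obtain t1 where t1: "t1 \<ge> t0" "w t1 < 0"
        using subcritical_inside_turns[OF d global(3)] global by auto
      have side: "g t1 < equilibrium d"
        by (rule solution_keeps_side(2)[OF d cmc_solution_subset[OF global(3)] t1(1)])
           (use inside global in auto)
      have dat: "g t1 > 0" "\<bar>w t1\<bar> < 1"
        using cmc_solutionD(1,2)[OF global(3), of t1] t1(1) by simp_all
      show False
      proof (rule falling_solution_not_global[OF d cmc_solution_subset[OF global(3)] t1(2)])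
        show "{t1..} \<subseteq> {t0..}"
          using t1 by auto
        show "potential d x < energy d (g t1) (w t1)" if "0 \<le> x" "x \<le> g t1" for x
        proof -
          have "potential d x \<le> potential d (g t1)"
            using side that by (intro potential_mono[OF d]) auto
          also have "\<dots> < energy d (g t1) (w t1)"
            using energy_ge_potential[OF d dat] energy_eq_potential_iff[OF d dat] t1(2) by auto
          finally show ?thesis .
        qed
      qed
    qed
    then show ?thesis ..
  qed
qed

section \<open>The hypersurface of stable perturbations\<close>
definition stable_branch :: "nat \<Rightarrow> (real \<times> real) set" where
  "stable_branch d = {(x, y). x > 0 \<and> y = stable_slope d x}"

lemma energy_strict_mono_speed:
  assumes "x > 0" and "\<bar>y\<bar> < \<bar>y'\<bar>" and "\<bar>y'\<bar> < 1"
  shows "energy d x y < energy d x y'"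
proof -
  have "y\<^sup>2 < y'\<^sup>2"
    using assms(2) by (simp add: abs_le_square_iff flip: not_le)
  moreover have "y'\<^sup>2 < 1"
    using assms(3) by (simp add: speed_less_one)
  ultimately show ?thesis
    using assms(1) by (auto simp: energy_def intro!: divide_strict_left_mono mult_pos_pos)
qed

context
  fixes d :: nat
  assumes d: "d \<ge> 1"
begin

text \<open>Above the critical energy there is no point of rest, so the sign of the velocity decides. Below it, the
side of the barrier decides. On the critical level, the points off the stable branch lie on the branch that
moves away from the equilibrium.\<close>
lemma off_stable_branch_dichotomy:
  assumes "z \<in> phase_space" and "z \<notin> stable_branch d"
  shows "collapses_in_finite_time d t0 z \<or> expands_indefinitely d t0 z"
proof -
  obtain x y where z: "z = (x, y)" "x > 0" "\<bar>y\<bar> < 1" "y \<noteq> stable_slope d x"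
    using assms by (cases z) (auto simp: phase_space_def stable_branch_def)
  define E where "E = energy d x y"
  let ?r = "equilibrium d" and ?E = "critical_energy d"
  have up: "expands_indefinitely d t0 z"
    if "(y > 0 \<and> (\<forall>u\<ge>x. potential d u < E)) \<or> (x > ?r \<and> E < ?E)"
    using expands_if[OF d z(2,3)] that by (simp add: z(1) E_def)
  have down: "collapses_in_finite_time d t0 z"
    if "(y < 0 \<and> (\<forall>u. 0 \<le> u \<longrightarrow> u \<le> x \<longrightarrow> potential d u < E)) \<or> (x < ?r \<and> E < ?E)"
    using collapses_if[OF d z(2,3)] that by (simp add: z(1) E_def)
  consider (less) "E < ?E" | (equal) "E = ?E" | (greater) "E > ?E"
    by linarith
  then show ?thesis
  proof cases
    case less
    then have "x \<noteq> ?r"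
      using energy_ge_potential[OF d z(2,3)] by (auto simp: E_def)
    then show ?thesis
      using up down less by (cases "x < ?r") auto
  next
    case equal
    have "y\<^sup>2 = (stable_slope d x)\<^sup>2"
      using energy_level(2)[OF z(2,3), of d ?E] equal stable_slope_on_critical_level[OF d z(2)]
      by (simp add: E_def)
    then have y: "y = - stable_slope d x" "stable_slope d x \<noteq> 0"
      using z(4) by (auto simp: power2_eq_iff)
    then have "x \<noteq> ?r"
      using stable_slope_sign(3)[OF d z(2)] by simp
    then consider "x < ?r" | "x > ?r"
      by linarith
    then show ?thesis
    proof cases
      case 1
      then have "y < 0"
        using stable_slope_sign(1)[OF d z(2)] y by simp
      moreover have "potential d u < E" if "0 \<le> u" "u \<le> x" for u
        using potential_less_critical[OF d, of u] that 1 equal by simp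
      ultimately show ?thesis
        using down by simp
    next
      case 2
      then have "y > 0"
        using stable_slope_sign(2)[OF d z(2)] y by simp
      moreover have "potential d u < E" if "x \<le> u" for u
        using potential_less_critical[OF d, of u] that 2 equal z(2) by simp
      ultimately show ?thesis
        using up by simp
    qed
  next
    case greater
    have pot: "potential d u < E" if "u \<ge> 0" for u
      using potential_le_critical[OF d that] greater by simp
    have "y \<noteq> 0"
      using energy_eq_potential_iff[OF d z(2,3)] pot[of x] z(2) by (auto simp: E_def)
    then show ?thesis
      using up down pot z(2) by (cases "y > 0") auto
  qed
qed

lemma stable_branch_subset: "stable_branch d \<subseteq> phase_space"
  using stable_slope_speed[OF d] by (auto simp: stable_branch_def phase_space_def abs_less_iff)

lemma continuous_on_branch_equation: "continuous_on phase_space (\<lambda>z. snd z - stable_slope d (fst z))"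
  by (intro continuous_intros continuous_on_compose2[OF continuous_on_stable_slope[OF d]])
     (auto simp: phase_space_def)

lemma open_phase_space: "open phase_space"
  unfolding phase_space_def by (intro open_Times) auto

lemma stable_branch_closedin: "closedin (top_of_set phase_space) (stable_branch d)"
proof -
  have "stable_branch d = phase_space \<inter> (\<lambda>z. snd z - stable_slope d (fst z)) -` {0}"
    using stable_branch_subset by (auto simp: stable_branch_def phase_space_def)
  then show ?thesis
    using continuous_closedin_preimage[OF continuous_on_branch_equation closed_singleton] by simp
qed

text \<open>As the graph of a continuously differentiable function, the branch is the zero set of
\<open>y - stable_slope d x\<close>, whose gradient has second component \<open>1\<close>.\<close>
lemma stable_branch_codim1: "codim1_submanifold phase_space (stable_branch d)"
  unfolding codim1_submanifold_def
proof (intro conjI ballI)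
  show "closedin (top_of_set phase_space) (stable_branch d)"
    by (rule stable_branch_closedin)
  fix z assume z: "z \<in> stable_branch d"
  obtain D where cD: "continuous_on {0<..} D"
    and D: "\<And>x. x > 0 \<Longrightarrow> (stable_slope d has_real_derivative D x) (at x)"
    using stable_slope_derivative[OF d] by metis
  define F where "F y = snd y - stable_slope d (fst y)" for y :: "real \<times> real"
  define G where "G y = (- D (fst y), 1 :: real)" for y :: "real \<times> real"
  have "(F has_derivative (\<lambda>h. G y \<bullet> h)) (at y)" if "y \<in> phase_space" for y
  proof -
    have "fst y > 0"
      using that by (auto simp: phase_space_def)
    then have "((\<lambda>y. stable_slope d (fst y)) has_derivative (\<lambda>h. D (fst y) * fst h)) (at y)"
      by (intro has_derivative_compose[of fst fst _ _ "stable_slope d"])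
         (auto intro!: derivative_eq_intros simp: D[unfolded has_field_derivative_def])
    then have "(F has_derivative (\<lambda>h. snd h - D (fst y) * fst h)) (at y)"
      unfolding F_def[abs_def] by (intro derivative_intros)
    then show ?thesis
      by (simp add: G_def inner_prod_def)
  qed
  moreover have "continuous_on phase_space G"
    unfolding G_def by (intro continuous_intros continuous_on_compose2[OF cD]) (auto simp: phase_space_def)
  moreover have "stable_branch d \<inter> phase_space = {y \<in> phase_space. F y = 0}"
    by (auto simp: stable_branch_def phase_space_def F_def)
  ultimately show "\<exists>V F G. open V \<and> z \<in> V \<and> V \<subseteq> phase_space \<and>
      (\<forall>y\<in>V. (F has_derivative (\<lambda>h. G y \<bullet> h)) (at y) \<and> G y \<noteq> 0) \<and>
      continuous_on V G \<and> stable_branch d \<inter> V = {y \<in> V. F y = (0 :: real)}"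
    using open_phase_space z stable_branch_subset
    by (intro exI[of _ phase_space] exI[of _ F] exI[of _ G]) (auto simp: G_def zero_prod_def)
qed

lemma off_stable_branch_dense: "phase_space \<subseteq> closure (phase_space - stable_branch d)"
proof
  fix z :: "real \<times> real" assume z: "z \<in> phase_space"
  show "z \<in> closure (phase_space - stable_branch d)"
  proof (cases "z \<in> stable_branch d")
    case False
    with z show ?thesis
      using closure_subset by blast
  next
    case True
    then obtain x y where xy: "z = (x, y)" "x > 0" "y = stable_slope d x" "\<bar>y\<bar> < 1"
      using stable_slope_speed[OF d] by (auto simp: stable_branch_def)
    show ?thesis
      unfolding closure_approachable
    proof (intro allI impI)
      fix e :: real assume "e > 0"
      define h where "h = min (e / 2) ((1 - y) / 2)"
      have "0 < h"
        using \<open>e > 0\<close> xy(4) by (auto simp: h_def)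
      moreover have "h \<le> e / 2" "h \<le> (1 - y) / 2"
        unfolding h_def by (rule min.cobounded1, rule min.cobounded2)
      ultimately have h: "0 < h" "h < e" "y + h < 1" "-1 < y + h"
        using xy(4) by auto
      then have "(x, y + h) \<in> phase_space - stable_branch d"
        using xy by (auto simp: phase_space_def stable_branch_def)
      moreover have "dist (x, y + h) z < e"
        using h by (simp add: xy(1) dist_Pair_Pair dist_real_def)
      ultimately show "\<exists>u\<in>phase_space - stable_branch d. dist u z < e"
        by blast
    qed
  qed
qed

lemma generic_collapse_or_expansion:
  "generic_in phase_space {z. collapses_in_finite_time d t0 z \<or> expands_indefinitely d t0 z}"
  unfolding generic_in_def
proof (intro exI conjI)
  show "open (phase_space - stable_branch d)"
    using openin_diff[OF openin_subtopology_self stable_branch_closedin] open_phase_space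
    by (simp add: openin_open_eq)
  show "phase_space - stable_branch d
      \<subseteq> {z. collapses_in_finite_time d t0 z \<or> expands_indefinitely d t0 z} \<inter> phase_space"
    using off_stable_branch_dichotomy by auto
qed (rule off_stable_branch_dense)

context
  fixes t0 :: real and f v :: "real \<Rightarrow> real"
  assumes sol: "cmc_solution d {t0..} f v" and lim: "(f \<longlongrightarrow> equilibrium d) at_top"
begin

lemma on_branch: "v t = stable_slope d (f t)" if "t \<ge> t0"
  by (rule converging_solution_on_stable_branch[OF d sol lim that])

lemma branch_flow: "f t > 0 \<and> (f has_real_derivative stable_slope d (f t)) (at t within {t0..})" if "t \<ge> t0"
  using cmc_solutionD(1,3)[OF sol, of t] on_branch[OF that] that by simp

lemma data_on_branch: "(f t0, v t0) \<in> stable_branch d"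
  using branch_flow[of t0] on_branch[of t0] by (simp add: stable_branch_def)

lemma asymptotic_on_branch:
  assumes "z \<in> stable_branch d"
  shows "future_asymptotic d t0 f v z"
proof -
  obtain x where x: "x > 0" "z = (x, stable_slope d x)"
    using assms by (auto simp: stable_branch_def)
  obtain g where g0: "g t0 = x"
    and g: "\<And>t. t \<ge> t0 \<Longrightarrow> g t > 0 \<and> (g has_real_derivative stable_slope d (g t)) (at t within {t0..})"
    using stable_flow_exists[OF d x(1)] by metis
  have "((\<lambda>t. (g t, stable_slope d (g t))) \<longlongrightarrow> (equilibrium d, 0)) at_top"
    by (intro tendsto_Pair stable_flow_converges[OF d g] stable_flow_slope_converges[OF d g])
  moreover have "((\<lambda>t. (f t, stable_slope d (f t))) \<longlongrightarrow> (equilibrium d, 0)) at_top"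
    by (intro tendsto_Pair lim stable_flow_slope_converges[OF d branch_flow])
  ultimately have "((\<lambda>t. dist (g t, stable_slope d (g t)) (f t, stable_slope d (f t))) \<longlongrightarrow>
      dist (equilibrium d, 0 :: real) (equilibrium d, 0)) at_top"
    by (rule tendsto_dist)
  then have "((\<lambda>t. dist (g t, stable_slope d (g t)) (f t, stable_slope d (f t))) \<longlongrightarrow> 0) at_top"
    by simp
  moreover have "eventually (\<lambda>t. dist (g t, stable_slope d (g t)) (f t, stable_slope d (f t))
      = dist (g t, stable_slope d (g t)) (f t, v t)) at_top"
    by (rule eventually_at_top_linorderI[of t0]) (simp add: on_branch)
  ultimately have "((\<lambda>t. dist (g t, stable_slope d (g t)) (f t, v t)) \<longlongrightarrow> 0) at_top"
    by (rule Lim_transform_eventually)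
  moreover have "cmc_solution d {t0..} g (\<lambda>t. stable_slope d (g t))"
    by (rule stable_flow_is_cmc[OF d g])
  ultimately show ?thesis
    unfolding future_asymptotic_def using g0 x(2)
    by (intro exI[of _ g] exI[of _ "\<lambda>t. stable_slope d (g t)"]) simp
qed

text \<open>Contraction bounds the distance of the radii by its initial value; a Lipschitz constant of the slope on
an interval containing both solutions carries this over to the velocities.\<close>
lemma stable_on_branch: "future_stable_within d t0 f v (stable_branch d)"
  unfolding future_stable_within_def
proof (intro allI impI)
  fix e :: real assume e: "e > 0"
  let ?r = "equilibrium d"
  define a b where "a = min (f t0) ?r / 2" and "b = max (f t0) ?r + 1"
  have a: "a > 0"
    using branch_flow[of t0] equilibrium_bounds[OF d] by (auto simp: a_def)
  have lower: "f t \<ge> min (f t0) ?r" if "t \<ge> t0" for t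
  proof (rule barrier_below[where f = f and v = "\<lambda>t. stable_slope d (f t)"])
    show "stable_slope d (f s) \<ge> 0" if "s \<ge> t0" "f s < min (f t0) ?r" for s
      using stable_slope_sign(1)[OF d, of "f s"] branch_flow[of s] that by simp
  qed (use branch_flow that in auto)
  have upper: "f t \<le> max (f t0) ?r" if "t \<ge> t0" for t
  proof (rule barrier_above[where f = f and v = "\<lambda>t. stable_slope d (f t)"])
    show "stable_slope d (f s) \<le> 0" if "s \<ge> t0" "f s > max (f t0) ?r" for s
      using stable_slope_sign(2)[OF d, of "f s"] branch_flow[of s] that by simp
  qed (use branch_flow that in auto)
  obtain L where L: "L-lipschitz_on {a..b} (stable_slope d)"
    by (rule C1_imp_lipschitz_on_Icc[OF stable_slope_C1_on[OF d]]) (use a in auto)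
  have L0: "L \<ge> 0"
    by (rule lipschitz_on_nonneg[OF L])
  define \<delta> where "\<delta> = min (min a 1) (e / (1 + L))"
  have "\<delta> \<le> e / (1 + L)"
    unfolding \<delta>_def by (rule min.cobounded2)
  then have "\<delta> * (1 + L) \<le> e"
    using L0 pos_le_divide_eq[of "1 + L" \<delta> e] by simp
  moreover have "\<delta> > 0" "\<delta> \<le> a" "\<delta> \<le> 1"
    using a e L0 by (auto simp: \<delta>_def)
  ultimately have \<delta>: "\<delta> > 0" "\<delta> \<le> a" "\<delta> \<le> 1" "\<delta> * (1 + L) \<le> e"
    by auto
  show "\<exists>\<delta>>0. \<forall>z\<in>stable_branch d. dist z (f t0, v t0) < \<delta> \<longrightarrow>
      (\<exists>g w. cmc_solution d {t0..} g w \<and> (g t0, w t0) = z \<and> (\<forall>t\<ge>t0. dist (g t, w t) (f t, v t) < e))"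
  proof (intro exI[of _ \<delta>] conjI ballI impI \<delta>(1))
    fix z assume z: "z \<in> stable_branch d" "dist z (f t0, v t0) < \<delta>"
    then obtain x where x: "x > 0" "z = (x, stable_slope d x)"
      by (auto simp: stable_branch_def)
    have close: "\<bar>x - f t0\<bar> < \<delta>"
      using dist_fst_le[of z "(f t0, v t0)"] z(2) by (simp add: x(2) dist_real_def)
    obtain g where g0: "g t0 = x"
      and g: "\<And>t. t \<ge> t0 \<Longrightarrow> g t > 0 \<and> (g has_real_derivative stable_slope d (g t)) (at t within {t0..})"
      using stable_flow_exists[OF d x(1)] by metis
    have "dist (g t, stable_slope d (g t)) (f t, v t) < e" if "t \<ge> t0" for t
    proof -
      have "\<bar>g t - f t\<bar> \<le> \<bar>g t0 - f t0\<bar>"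
        by (rule decreasing_field_contracts[where F = "stable_slope d"])
           (use stable_slope_antimono[OF d] g branch_flow that in auto)
      then have gf: "\<bar>g t - f t\<bar> < \<delta>"
        using close g0 by simp
      then have "g t \<in> {a..b}" "f t \<in> {a..b}"
        using lower[OF that] upper[OF that] \<delta> a by (auto simp: a_def b_def abs_less_iff)
      then have "\<bar>stable_slope d (g t) - stable_slope d (f t)\<bar> \<le> L * \<bar>g t - f t\<bar>"
        using lipschitz_onD[OF L] by (simp add: dist_real_def)
      then have "dist (g t, stable_slope d (g t)) (f t, v t) \<le> \<bar>g t - f t\<bar> + L * \<bar>g t - f t\<bar>"
        using sqrt_sum_squares_le_sum_abs[of "g t - f t" "stable_slope d (g t) - stable_slope d (f t)"]
        by (simp add: dist_Pair_Pair dist_real_def on_branch[OF that])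
      also have "\<dots> = \<bar>g t - f t\<bar> * (1 + L)"
        by (simp add: algebra_simps)
      also have "\<dots> < \<delta> * (1 + L)"
        using gf L0 by (intro mult_strict_right_mono) auto
      also have "\<dots> \<le> e"
        by (rule \<delta>(4))
      finally show ?thesis .
    qed
    then show "\<exists>g w. cmc_solution d {t0..} g w \<and> (g t0, w t0) = z \<and>
        (\<forall>t\<ge>t0. dist (g t, w t) (f t, v t) < e)"
      using stable_flow_is_cmc[OF d g] g0 x(2)
      by (intro exI[of _ g] exI[of _ "\<lambda>t. stable_slope d (g t)"]) simp
  qed
qed

text \<open>Raising the initial speed a little lifts the energy above critical. Such a solution either fails to be
global or expands indefinitely, so it cannot stay within distance \<open>1\<close> of the converging solution \<open>f\<close>.\<close>
lemma unstable_in_phase_space: "future_unstable d t0 f v"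
  unfolding future_unstable_def
proof
  assume "future_stable_within d t0 f v phase_space"
  then obtain \<delta> where \<delta>: "\<delta> > 0"
    and stable: "\<And>z. z \<in> phase_space \<Longrightarrow> dist z (f t0, v t0) < \<delta> \<Longrightarrow>
      \<exists>g w. cmc_solution d {t0..} g w \<and> (g t0, w t0) = z \<and> (\<forall>t\<ge>t0. dist (g t, w t) (f t, v t) < 1)"
    unfolding future_stable_within_def by (metis zero_less_one)
  have dat: "f t0 > 0" "\<bar>v t0\<bar> < 1"
    using cmc_solutionD(1,2)[OF sol, of t0] by simp_all
  define h where "h = min (\<delta> / 2) ((1 - \<bar>v t0\<bar>) / 2)"
  have "0 < h"
    using \<delta> dat by (auto simp: h_def)
  moreover have "h \<le> \<delta> / 2" "h \<le> (1 - \<bar>v t0\<bar>) / 2"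
    unfolding h_def by (rule min.cobounded1, rule min.cobounded2)
  ultimately have h: "0 < h" "h < \<delta>" "\<bar>v t0\<bar> + h < 1"
    using dat(2) by auto
  define y where "y = (if v t0 \<ge> 0 then v t0 + h else v t0 - h)"
  have y: "\<bar>v t0\<bar> < \<bar>y\<bar>" "\<bar>y\<bar> < 1" "\<bar>y - v t0\<bar> < \<delta>"
    using h by (auto simp: y_def)
  have "(f t0, y) \<in> phase_space"
    using dat y by (auto simp: phase_space_def abs_less_iff)
  moreover have "dist (f t0, y) (f t0, v t0) < \<delta>"
    using y by (simp add: dist_Pair_Pair dist_real_def)
  ultimately obtain g w where g: "cmc_solution d {t0..} g w" "g t0 = f t0" "w t0 = y"
    and near: "\<And>t. t \<ge> t0 \<Longrightarrow> dist (g t, w t) (f t, v t) < 1"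
    using stable by (metis prod.inject)
  have allowed: "potential d x < energy d (g t0) (w t0)" if "x \<ge> 0" for x
    using potential_le_critical[OF d that] converging_solution_energy[OF d sol lim, of t0]
      energy_strict_mono_speed[OF dat(1) y(1,2), of d] by (simp add: g)
  have "\<not> w t0 < 0"
    using falling_solution_not_global[OF d g(1)] allowed by blast
  then have "w t0 > 0"
    using y(1) g(3) by auto
  then have "filterlim g at_top at_top"
    using allowed dat(1) g(2) by (intro rising_solution_expands[OF d g(1)]) auto
  then have "eventually (\<lambda>t. g t \<ge> equilibrium d + 2) at_top"
    by (simp add: filterlim_at_top)
  moreover have "eventually (\<lambda>t. f t < equilibrium d + 1) at_top"
    using lim by (rule order_tendstoD) simp
  moreover have "eventually (\<lambda>t. t \<ge> t0) at_top"
    by (rule eventually_ge_at_top)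
  ultimately have "eventually (\<lambda>t :: real. False) at_top"
  proof eventually_elim
    case (elim t)
    have "\<bar>g t - f t\<bar> < 1"
      using dist_fst_le[of "(g t, w t)" "(f t, v t)"] near[of t] elim by (simp add: dist_real_def)
    with elim show False
      by linarith
  qed
  then show False
    by simp
qed

end

end

theorem theorem2p21:
  fixes d :: nat and t0 :: real and f v :: "real \<Rightarrow> real"
  assumes "d \<ge> 1"
    and "cmc_solution d {t0..} f v"
    and "(f \<longlongrightarrow> real d / (real d + 1)) at_top"
  shows "future_unstable d t0 f v \<and>
    (\<exists>U M. open U \<and> U \<subseteq> phase_space \<and> (f t0, v t0) \<in> M \<and> M \<subseteq> U \<and>
       generic_in U {z. collapses_in_finite_time d t0 z \<or> expands_indefinitely d t0 z} \<and>
       (\<forall>z\<in>U - M. collapses_in_finite_time d t0 z \<or> expands_indefinitely d t0 z) \<and>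
       codim1_submanifold U M \<and>
       future_stable_within d t0 f v M \<and>
       (\<forall>z\<in>M. future_asymptotic d t0 f v z))"
proof -
  note d = assms(1) and sol = assms(2)
  have lim: "(f \<longlongrightarrow> equilibrium d) at_top"
    using assms(3) by (simp add: equilibrium_def)
  show ?thesis
    using unstable_in_phase_space[OF d sol lim] open_phase_space data_on_branch[OF d sol lim]
      stable_branch_subset[OF d] generic_collapse_or_expansion[OF d] off_stable_branch_dichotomy[OF d]
      stable_branch_codim1[OF d] stable_on_branch[OF d sol lim] asymptotic_on_branch[OF d sol lim]
    by (intro conjI exI[of _ phase_space] exI[of _ "stable_branch d"]) auto
qed

end
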